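(* There are positive absolute constants $d_1 \le 2$ and $d_2 \le 12$ such that the following hold for all positive integers $m, n, M$ with $n \ge 5$ and all integral vectors $\ell_1, w_1 \in \mathbb{Z}^m$, $\ell_2, w_2 \in \mathbb{Z}^n$ with $w_2 > \ell_2$ (componentwise). (1) If $$M > \big(d_1\, n\, \|(w_1;w_2)-(\ell_1;\ell_2)\|\big)^{n/m+1},$$ then for almost all $A \in G_{m,n}(M)$ reverse branch-and-bound solves the RKZ-rangespace reformulation of the problem (IP) at the rootnode. (2) Suppose in addition that $m \le n$, $w_1 = \ell_1$ and $\chi_{m,n}(M) \ge 1/2$. If $$M > \big(d_2\, (n-m)\, \|w_2-\ell_2\|\big)^{n/m},$$ then for almost all $A \in G'_{m,n}(M)$ reverse branch-and-bound solves the RKZ-nullspace reformulation of (IP) at the rootnode. Here (IP) is the problem: find $x \in Q \cap \mathbb{Z}^n$, where $Q = \{x \in \mathbb{R}^n : \ell_1 \le Ax \le w_1,\ \ell_2 \le x \le w_2\}$.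
   Context: Norms are Euclidean, $I$ is the identity matrix, and $(A;B)$ denotes the matrix (or vector) obtained by stacking $A$ on top of $B$. Matrix sets. $G_{m,n}(M)$ is the set of $m\times n$ matrices with entries in $\{1,\dots,M\}$; $G'_{m,n}(M)$ is the subset of those with linearly independent rows; $\chi_{m,n}(M) = |G'_{m,n}(M)|/|G_{m,n}(M)|$. A statement is true for almost all elements of a finite set $S$ if it holds for all but at most a fraction $1/2^n$ of the elements of $S$ (with $n$ the number of columns of $A$). Lattices and RKZ reduction. A lattice is $L = \mathbb{L}(B) = \{Bx : x \in \mathbb{Z}^r\}$, with $B$ a real matrix with $r$ linearly independent columns $b_1,\dots,b_r$ (a basis of $L$). The Gram-Schmidt vectors are $b_1^* = b_1$ and $b_i^*$ = the projection of $b_i$ onto the orthogonal complement of the span of $b_1,\dots,b_{i-1}$; $\mu_{ij} = \langle b_i,b_j^*\rangle/\|b_j^*\|^2$ for $j<i$. For $1\le k\le i\le r$ let $b_i(k) = b_i^* + \sum_{j=k}^{i-1}\mu_{ij}b_j^*$, and let $L_i$ be the lattice generated by $b_i(i), b_{i+1}(i),\dots,b_r(i)$. The basis is Korkhine-Zolotarev (KZ) reduced if $b_i(i)$ is a shortest nonzero vector of $L_i$ for every $i$. The reciprocal lattice of $L$ is $L' = \{z \in \operatorname{lin} L : \langle z,x\rangle \in \mathbb{Z}\ \forall x\in L\}$ ($\operatorname{lin}$ is linear span); the reciprocal basis of $b_1,\dots,b_r$ is the basis $b_1',\dots,b_r'$ of $L'$ with $\langle b_i,b_j'\rangle = 1$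 if $i+j=r+1$ and $0$ otherwise. The basis $b_1,\dots,b_r$ is reciprocal Korkhine-Zolotarev (RKZ) reduced if its reciprocal basis is a KZ reduced basis of $L'$. Reformulations. The RKZ-rangespace reformulation of (IP) is: find $y \in Q_R \cap \mathbb{Z}^n$, where $Q_R = \{y \in \mathbb{R}^n : (\ell_1;\ell_2) \le (A;I)Uy \le (w_1;w_2)\}$ and $U$ is a unimodular matrix such that the columns of $(A;I)U$ form an RKZ reduced basis of $\mathbb{L}((A;I))$. The RKZ-nullspace reformulation is applicable when the rows of $A$ are linearly independent and $w_1 = \ell_1$; it is: find $y \in Q_N\cap\mathbb{Z}^{n-m}$, where $Q_N = \{y \in \mathbb{R}^{n-m} : \ell_2 - x_0 \le By \le w_2 - x_0\}$, $x_0\in\mathbb{Z}^n$ satisfies $Ax_0=\ell_1$, and the columns of $B$ are an RKZ reduced basis of $\{x\in\mathbb{Z}^n : Ax=0\}$. (If no such $x_0$ exists, (IP) is infeasible and there is no reformulated problem to solve; if $m=n$ there are no variables to branch on.) The assertions are for any admissible choice of $U$, $B$, $x_0$. Branch-and-bound. Reverse branch-and-bound applied to a polyhedron $P\subset\mathbb{R}^r$ in variables $y_1,\dots,y_r$ starts with $P$ as the sole subproblem and branches on the variables in the order $y_r, y_{r-1},\dots,y_1$: branching on $y_i$ in a subproblem $P'$ creates the nodes $P'\cap\{y : y_i=\gamma\}$, where $\gamma$ ranges over all integers with $\min\{y_i : y\in P'\}\le\gamma\le\max\{y_i : y\in P'\}$ (no nodes if $P'$ is empty). This is repeated until all subproblems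 are shown to be empty or an integral point is found. The nodes created by branching on $y_i$ form the level of $y_i$. Branch-and-bound solves the problem at the rootnode if it generates at most one node at each level of the tree. *)

theory Defs
  imports
    Complex_Main
    "Jordan_Normal_Form.Gram_Schmidt"
    "Jordan_Normal_Form.Matrix_Kernel"
begin

text \<open>
  All matrices, vectors and lists are indexed from \<open>0\<close>: the vector written
  \<open>b\<^sub>i\<close> on paper (with \<open>1 \<le> i \<le> r\<close>) is the list entry \<open>bs ! (i - 1)\<close>, and the variable \<open>y\<^sub>i\<close>
  is the component \<open>y $ (i - 1)\<close>.  A basis in \<open>d\<close>-dimensional real space is a list of
  vectors in \<open>carrier_vec d\<close>; the basis given by a matrix is the list of its columns.
\<close>

abbreviation real_vec :: "int vec \<Rightarrow> real vec" where
  "real_vec \<equiv> map_vec real_of_int"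

abbreviation real_mat :: "int mat \<Rightarrow> real mat" where
  "real_mat \<equiv> map_mat real_of_int"

definition vec_norm :: "real vec \<Rightarrow> real" where
  "vec_norm v = sqrt (v \<bullet> v)"

definition lin_indpt_list :: "nat \<Rightarrow> real vec list \<Rightarrow> bool" where
  "lin_indpt_list d bs \<longleftrightarrow>
     set bs \<subseteq> carrier_vec d \<and> distinct bs \<and>
     \<not> LinearCombinations.module.lin_dep class_ring (module_vec TYPE(real) d) (set bs)"

definition lin_hull :: "nat \<Rightarrow> real vec set \<Rightarrow> real vec set" where
  "lin_hull d S = LinearCombinations.module.span class_ring (module_vec TYPE(real) d) S"

definition G_mats :: "nat \<Rightarrow> nat \<Rightarrow> nat \<Rightarrow> int mat set" where
  "G_mats m n M = {A \<in> carrier_mat m n. \<forall>i<m. \<forall>j<n. A $$ (i, j) \<in> {1..int M}}"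

definition indep_rows :: "int mat \<Rightarrow> bool" where
  "indep_rows A \<longleftrightarrow> lin_indpt_list (dim_col A) (rows (real_mat A))"

definition G'_mats :: "nat \<Rightarrow> nat \<Rightarrow> nat \<Rightarrow> int mat set" where
  "G'_mats m n M = {A \<in> G_mats m n M. indep_rows A}"

definition chi :: "nat \<Rightarrow> nat \<Rightarrow> nat \<Rightarrow> real" where
  "chi m n M = real (card (G'_mats m n M)) / real (card (G_mats m n M))"

text \<open>Only meant for finite \<open>S\<close>; here \<open>n\<close> is the number of columns of the matrices in \<open>S\<close>.\<close>

definition for_almost_all :: "nat \<Rightarrow> 'a set \<Rightarrow> ('a \<Rightarrow> bool) \<Rightarrow> bool" where
  "for_almost_all n S P \<longleftrightarrow> real (card {A \<in> S. \<not> P A}) \<le> (1 / 2 ^ n) * real (card S)"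

abbreviation lattice_gen :: "nat \<Rightarrow> real vec list \<Rightarrow> real vec set" where
  "lattice_gen d bs \<equiv> vec_module.lattice_of d bs"

definition lattice_basis :: "nat \<Rightarrow> real vec list \<Rightarrow> real vec set \<Rightarrow> bool" where
  "lattice_basis d bs L \<longleftrightarrow> lin_indpt_list d bs \<and> lattice_gen d bs = L"

text \<open>The library's \<open>gram_schmidt\<close> does not normalize, so \<open>gs_vec d bs i\<close> is the component of
  \<open>bs ! i\<close> orthogonal to the span of the preceding vectors.\<close>

definition gs_vec :: "nat \<Rightarrow> real vec list \<Rightarrow> nat \<Rightarrow> real vec" where
  "gs_vec d bs i = gram_schmidt d bs ! i"

definition gs_coeff :: "nat \<Rightarrow> real vec list \<Rightarrow> nat \<Rightarrow> nat \<Rightarrow> real" where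
  "gs_coeff d bs i j = (bs ! i \<bullet> gs_vec d bs j) / (vec_norm (gs_vec d bs j))\<^sup>2"

text \<open>\<open>proj_vec d bs k i\<close> is \<open>b\<^sub>i(k)\<close>, for \<open>k \<le> i\<close>.\<close>

definition proj_vec :: "nat \<Rightarrow> real vec list \<Rightarrow> nat \<Rightarrow> nat \<Rightarrow> real vec" where
  "proj_vec d bs k i =
     gs_vec d bs i +
     finsum_vec TYPE(real) d (\<lambda>j. gs_coeff d bs i j \<cdot>\<^sub>v gs_vec d bs j) {k..<i}"

definition proj_lattice :: "nat \<Rightarrow> real vec list \<Rightarrow> nat \<Rightarrow> real vec set" where
  "proj_lattice d bs i = lattice_gen d (map (proj_vec d bs i) [i..<length bs])"

definition shortest_nonzero :: "nat \<Rightarrow> real vec set \<Rightarrow> real vec \<Rightarrow> bool" where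
  "shortest_nonzero d L v \<longleftrightarrow>
     v \<in> L \<and> v \<noteq> 0\<^sub>v d \<and> (\<forall>x\<in>L. x \<noteq> 0\<^sub>v d \<longrightarrow> vec_norm v \<le> vec_norm x)"

definition KZ_reduced_basis :: "nat \<Rightarrow> real vec list \<Rightarrow> real vec set \<Rightarrow> bool" where
  "KZ_reduced_basis d bs L \<longleftrightarrow>
     lattice_basis d bs L \<and>
     (\<forall>i<length bs. shortest_nonzero d (proj_lattice d bs i) (proj_vec d bs i i))"

definition reciprocal_lattice :: "nat \<Rightarrow> real vec set \<Rightarrow> real vec set" where
  "reciprocal_lattice d L = {z \<in> lin_hull d L. \<forall>x\<in>L. z \<bullet> x \<in> \<int>}"

text \<open>With indices starting at \<open>0\<close>, the condition \<open>i + j = r + 1\<close> becomes \<open>i + j + 1 = r\<close>.\<close>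

definition reciprocal_basis :: "nat \<Rightarrow> real vec list \<Rightarrow> real vec list \<Rightarrow> bool" where
  "reciprocal_basis d bs bs' \<longleftrightarrow>
     length bs' = length bs \<and>
     lattice_basis d bs' (reciprocal_lattice d (lattice_gen d bs)) \<and>
     (\<forall>i<length bs. \<forall>j<length bs.
        bs ! i \<bullet> bs' ! j = (if i + j + 1 = length bs then 1 else 0))"

text \<open>The reciprocal basis of a given basis exists and is unique, so the quantifier below
  merely names it.\<close>

definition RKZ_reduced_basis :: "nat \<Rightarrow> real vec list \<Rightarrow> real vec set \<Rightarrow> bool" where
  "RKZ_reduced_basis d bs L \<longleftrightarrow>
     lattice_basis d bs L \<and>
     (\<exists>bs'. reciprocal_basis d bs bs' \<and> KZ_reduced_basis d bs' (reciprocal_lattice d L))"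

definition unimodular :: "nat \<Rightarrow> int mat \<Rightarrow> bool" where
  "unimodular n U \<longleftrightarrow> U \<in> carrier_mat n n \<and> \<bar>det U\<bar> = 1"

definition stack_id :: "int mat \<Rightarrow> int mat" where
  "stack_id A = A @\<^sub>r 1\<^sub>m (dim_col A)"

definition rangespace_transform :: "int mat \<Rightarrow> int mat \<Rightarrow> bool" where
  "rangespace_transform A U \<longleftrightarrow>
     unimodular (dim_col A) U \<and>
     RKZ_reduced_basis (dim_row A + dim_col A) (cols (real_mat (stack_id A * U)))
       (lattice_gen (dim_row A + dim_col A) (cols (real_mat (stack_id A))))"

text \<open>The library order on type \<open>vec\<close> is the componentwise one.\<close>

definition rangespace_polyhedron ::
  "int mat \<Rightarrow> int vec \<Rightarrow> int vec \<Rightarrow> int vec \<Rightarrow> int vec \<Rightarrow> int mat \<Rightarrow> real vec set" where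
  "rangespace_polyhedron A l1 w1 l2 w2 U =
     {y \<in> carrier_vec (dim_col A).
        real_vec (l1 @\<^sub>v l2) \<le> real_mat (stack_id A * U) *\<^sub>v y \<and>
        real_mat (stack_id A * U) *\<^sub>v y \<le> real_vec (w1 @\<^sub>v w2)}"

definition nullspace_basis :: "int mat \<Rightarrow> int mat \<Rightarrow> bool" where
  "nullspace_basis A B \<longleftrightarrow>
     B \<in> carrier_mat (dim_col A) (dim_col A - dim_row A) \<and>
     RKZ_reduced_basis (dim_col A) (cols (real_mat B)) (real_vec ` mat_kernel A)"

definition nullspace_polyhedron ::
  "int mat \<Rightarrow> int vec \<Rightarrow> int vec \<Rightarrow> int mat \<Rightarrow> int vec \<Rightarrow> real vec set" where
  "nullspace_polyhedron A l2 w2 B x0 =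
     {y \<in> carrier_vec (dim_col A - dim_row A).
        real_vec (l2 - x0) \<le> real_mat B *\<^sub>v y \<and>
        real_mat B *\<^sub>v y \<le> real_vec (w2 - x0)}"

text \<open>
  A node of the tree is represented by the list \<open>[\<gamma>\<^sub>r, \<gamma>\<^sub>r\<^sub>-\<^sub>1, \<dots>]\<close> of the values assigned so far
  to \<open>y\<^sub>r, y\<^sub>r\<^sub>-\<^sub>1, \<dots>\<close>; the root is \<open>[]\<close>.
\<close>

definition bb_subproblem :: "nat \<Rightarrow> real vec set \<Rightarrow> int list \<Rightarrow> real vec set" where
  "bb_subproblem r P \<gamma>s = {y \<in> P. \<forall>k<length \<gamma>s. y $ (r - 1 - k) = real_of_int (\<gamma>s ! k)}"

text \<open>
  The premises on \<open>u\<close> and \<open>v\<close> express \<open>min {y\<^sub>i | y \<in> P'} \<le> \<gamma> \<le> max {y\<^sub>i | y \<in> P'}\<close> for the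
  current subproblem \<open>P'\<close>, and they fail for every \<open>\<gamma>\<close> if \<open>P'\<close> is empty.  A subproblem whose
  variables are all fixed is empty or an integral point and is not branched on.  The tree is the
  complete one: no node is discarded because an integral point has been found elsewhere, so a
  bound on its levels holds for every order of processing the nodes and for every
  way of stopping early.
\<close>

inductive_set bb_nodes :: "nat \<Rightarrow> real vec set \<Rightarrow> int list set"
  for r :: nat and P :: "real vec set" where
  root: "[] \<in> bb_nodes r P"
| branch: "\<lbrakk>\<gamma>s \<in> bb_nodes r P; length \<gamma>s < r;
    u \<in> bb_subproblem r P \<gamma>s; u $ (r - 1 - length \<gamma>s) \<le> real_of_int \<gamma>;
    v \<in> bb_subproblem r P \<gamma>s; real_of_int \<gamma> \<le> v $ (r - 1 - length \<gamma>s)\<rbrakk>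
    \<Longrightarrow> \<gamma>s @ [\<gamma>] \<in> bb_nodes r P"

text \<open>The level of \<open>y\<^sub>i\<close>, for \<open>1 \<le> i \<le> r\<close>: the nodes in which \<open>y\<^sub>r, \<dots>, y\<^sub>i\<close> have been fixed.\<close>

definition bb_level :: "nat \<Rightarrow> real vec set \<Rightarrow> nat \<Rightarrow> int list set" where
  "bb_level r P i = {\<gamma>s \<in> bb_nodes r P. length \<gamma>s = r + 1 - i}"

definition solves_at_rootnode :: "nat \<Rightarrow> real vec set \<Rightarrow> bool" where
  "solves_at_rootnode r P \<longleftrightarrow>
     (\<forall>i\<in>{1..r}. finite (bb_level r P i) \<and> card (bb_level r P i) \<le> 1)"

definition rangespace_solved_at_rootnode ::
  "int mat \<Rightarrow> int vec \<Rightarrow> int vec \<Rightarrow> int vec \<Rightarrow> int vec \<Rightarrow> bool" where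
  "rangespace_solved_at_rootnode A l1 w1 l2 w2 \<longleftrightarrow>
     (\<forall>U. rangespace_transform A U \<longrightarrow>
        solves_at_rootnode (dim_col A) (rangespace_polyhedron A l1 w1 l2 w2 U))"

definition nullspace_solved_at_rootnode ::
  "int mat \<Rightarrow> int vec \<Rightarrow> int vec \<Rightarrow> int vec \<Rightarrow> bool" where
  "nullspace_solved_at_rootnode A l1 l2 w2 \<longleftrightarrow>
     (\<forall>B x0. nullspace_basis A B \<and> x0 \<in> carrier_vec (dim_col A) \<and> A *\<^sub>v x0 = l1 \<longrightarrow>
        solves_at_rootnode (dim_col A - dim_row A) (nullspace_polyhedron A l2 w2 B x0))"

end

theory Submission imports Defs
begin

text \<open>
  If \<open>b'\<^sub>1, \<dots>, b'\<^sub>r\<close> is the reciprocal basis, then the Gram-Schmidt vector \<open>z\<close> of \<open>b'\<^sub>r\<^sub>-\<^sub>i\<^sub>+\<^sub>1\<close>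
  is orthogonal to \<open>b\<^sub>1, \<dots>, b\<^sub>i\<^sub>-\<^sub>1\<close> and satisfies \<open>\<langle>b\<^sub>i, z\<rangle> = 1\<close>.  Hence two points of the polyhedron that
  agree in \<open>y\<^sub>i\<^sub>+\<^sub>1, \<dots>, y\<^sub>r\<close> differ in \<open>y\<^sub>i\<close> by at most \<open>\<parallel>w - l\<parallel> \<parallel>z\<parallel>\<close>, and branch-and-bound stays at the
  root as soon as this is less than 1 for every \<open>i\<close>.  By KZ reducedness \<open>z\<close> is a shortest vector of a
  projected reciprocal lattice, which is dual to the lattice generated by \<open>b\<^sub>1, \<dots>, b\<^sub>i\<close>.  Bounding the
  shortest vectors of both lattices by their determinants, the determinants cancel, and \<open>\<parallel>z\<parallel>\<close> times
  the length of a shortest vector of the lattice is at most \<open>(i/3) 4\<^bsup>1/i\<^esup>\<close>.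

  So a bad matrix \<open>A\<close> admits a short nonzero integral vector \<open>z\<close> with \<open>Az\<close> short (respectively \<open>Az = 0\<close>).
  For given \<open>z \<noteq> 0\<close> and \<open>y\<close> the equation \<open>Az = y\<close> determines one column of \<open>A\<close> from the others, so it
  holds for at most a fraction \<open>1/M\<^sup>m\<close> of the matrices, and counting the pairs \<open>(y, z)\<close> in a cube finishes
  the proof.
\<close>

section \<open>A Blichfeldt-type bound for triangular forms\<close>

text \<open>Mean and variance: \<open>c + (real n - 1) / 2\<close> is the mean of the progression
  and \<open>(n^2 - 1) / 12\<close> its variance.\<close>

lemma arith_progression_sum_squares:
  fixes c :: real
  shows "(\<Sum>t<n. (c + real t)\<^sup>2) = real n * (c + (real n - 1) / 2)\<^sup>2 + real n * ((real n)\<^sup>2 - 1) / 12"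
proof (induction n)
  case 0
  then show ?case by simp
next
  case (Suc n)
  have "real (Suc n) * (c + (real (Suc n) - 1) / 2)\<^sup>2 + real (Suc n) * ((real (Suc n))\<^sup>2 - 1) / 12
      = real n * (c + (real n - 1) / 2)\<^sup>2 + real n * ((real n)\<^sup>2 - 1) / 12 + (c + real n)\<^sup>2"
    by (simp add: power2_eq_square field_simps)
  then show ?case using Suc by simp
qed

text \<open>Rounding the exact centring shift \<open>y\<close> leaves the mean within 1/2 of 0. This
  adds at most 1/4 to the variance \<open>(n^2 - 1) / 12\<close>, whence
  \<open>(n^2 + 2) / 12\<close>.\<close>

lemma centred_arith_progression:
  fixes \<nu> :: real
  shows "\<exists>a::int. (\<Sum>t<n. (\<nu> + real_of_int (a + int t))\<^sup>2) \<le> real n * ((real n)\<^sup>2 + 2) / 12"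
proof -
  define y where "y = - \<nu> - (real n - 1) / 2"
  have "\<bar>real_of_int (round y) - y\<bar> \<le> 1 / 2"
    by (rule of_int_round_abs_le)
  then have "(real_of_int (round y) - y)\<^sup>2 \<le> (1 / 2)\<^sup>2"
    by (intro abs_le_square_iff[THEN iffD1]) simp
  then have "real n * (\<nu> + real_of_int (round y) + (real n - 1) / 2)\<^sup>2 \<le> real n * (1 / 4)"
    by (intro mult_left_mono) (simp_all add: y_def power2_eq_square algebra_simps)
  then have "(\<Sum>t<n. (\<nu> + real_of_int (round y) + real t)\<^sup>2) \<le> real n * ((real n)\<^sup>2 + 2) / 12"
    unfolding arith_progression_sum_squares by (simp add: field_simps)
  then show ?thesis
    by (intro exI[of _ "round y"]) (simp add: algebra_simps)
qed

text \<open>By \<open>add\<close> and \<open>tri\<close>, \<open>p i u\<close> depends only on the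
  entries of \<open>u\<close> up to index \<open>i\<close>, so the set is built one coordinate at a
  time: changing the newest entry leaves the earlier \<open>p i\<close> alone and lets
  \<open>p r\<close> run through \<open>N r\<close> terms of step \<open>g r\<close>, centred
  separately for each point. The result is a discrete, sheared version of a centred box with sides
  \<open>g i * N i\<close>.\<close>

lemma triangular_box:
  fixes p :: "nat \<Rightarrow> (nat \<Rightarrow> int) \<Rightarrow> real" and g :: "nat \<Rightarrow> real" and N :: "nat \<Rightarrow> nat"
  assumes add: "\<And>i u v. i < r \<Longrightarrow> p i (\<lambda>j. u j - v j) = p i u - p i v"
    and tri: "\<And>i u. i < r \<Longrightarrow> \<forall>j<i. u j = 0 \<Longrightarrow> p i u = g i * real_of_int (u i)"
    and g: "\<And>i. i < r \<Longrightarrow> 0 < g i"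
  shows "\<exists>S. finite S \<and> card S = (\<Prod>i<r. N i) \<and> (\<forall>u\<in>S. \<forall>j\<ge>r. u j = 0) \<and>
    (\<Sum>u\<in>S. \<Sum>i<r. (p i u)\<^sup>2) \<le> real (card S) * (\<Sum>i<r. (g i)\<^sup>2 * ((real (N i))\<^sup>2 + 2) / 12)"
  using assms
proof (induction r)
  case 0
  show ?case
    by (intro exI[of _ "{\<lambda>_. 0}"]) simp
next
  case (Suc r)
  have "\<exists>S. finite S \<and> card S = (\<Prod>i<r. N i) \<and> (\<forall>u\<in>S. \<forall>j\<ge>r. u j = 0) \<and>
    (\<Sum>u\<in>S. \<Sum>i<r. (p i u)\<^sup>2) \<le> real (card S) * (\<Sum>i<r. (g i)\<^sup>2 * ((real (N i))\<^sup>2 + 2) / 12)"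
    by (rule Suc.IH) (simp_all add: Suc.prems)
  then obtain S where S: "finite S" "card S = (\<Prod>i<r. N i)" "\<forall>u\<in>S. \<forall>j\<ge>r. u j = 0"
    and sumS: "(\<Sum>u\<in>S. \<Sum>i<r. (p i u)\<^sup>2)
      \<le> real (card S) * (\<Sum>i<r. (g i)\<^sup>2 * ((real (N i))\<^sup>2 + 2) / 12)"
    by blast
  have gr: "g r > 0" using Suc.prems by simp
  have "\<forall>u. \<exists>a::int. (\<Sum>t<N r. (p r u / g r + real_of_int (a + int t))\<^sup>2)
      \<le> real (N r) * ((real (N r))\<^sup>2 + 2) / 12"
    by (intro allI centred_arith_progression)
  from choice[OF this] obtain a where a: "\<And>u. (\<Sum>t<N r. (p r u / g r + real_of_int (a u + int t))\<^sup>2)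
      \<le> real (N r) * ((real (N r))\<^sup>2 + 2) / 12"
    by blast
  define f where "f = (\<lambda>(u, t). u(r := a u + int t))"
  \<comment> \<open>All points of \<open>S\<close> vanish at index \<open>r\<close>, so overwriting
    that entry loses nothing.\<close>
  have inj: "inj_on f (S \<times> {..<N r})"
  proof (rule inj_onI, clarify)
    fix u t u' t' assume u: "u \<in> S" "u' \<in> S" and eq: "f (u, t) = f (u', t')"
    have "u = u'"
    proof
      fix j show "u j = u' j"
        using fun_cong[OF eq, of j] bspec[OF S(3) u(1)] bspec[OF S(3) u(2)]
        by (cases "j = r") (auto simp: f_def)
    qed
    then show "u = u' \<and> t = t'"
      using fun_cong[OF eq, of r] by (simp add: f_def)
  qed
  have low: "p i (f (u, t)) = p i u" if "i < r" for i u t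
  proof -
    have "p i (\<lambda>j. f (u, t) j - u j) = g i * real_of_int (f (u, t) i - u i)"
      using that by (intro Suc.prems(2)) (auto simp: f_def)
    moreover have "f (u, t) i = u i"
      using that by (simp add: f_def)
    ultimately show ?thesis
      using Suc.prems(1)[of i "f (u, t)" u] that by simp
  qed
  have top: "p r (f (u, t)) = g r * (p r u / g r + real_of_int (a u + int t))" if "u \<in> S" for u t
  proof -
    have "p r (\<lambda>j. f (u, t) j - u j) = g r * real_of_int (f (u, t) r - u r)"
      by (intro Suc.prems(2)) (auto simp: f_def)
    moreover have "f (u, t) r - u r = a u + int t"
      using that S(3) by (simp add: f_def)
    ultimately show ?thesis
      using Suc.prems(1)[of r "f (u, t)" u] gr by (simp add: algebra_simps)
  qed
  have "(\<Sum>u\<in>f ` (S \<times> {..<N r}). \<Sum>i<Suc r. (p i u)\<^sup>2)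
      = (\<Sum>x\<in>S \<times> {..<N r}. \<Sum>i<Suc r. (p i (f x))\<^sup>2)"
    by (subst sum.reindex[OF inj]) simp
  also have "\<dots> = (\<Sum>u\<in>S. \<Sum>t<N r. \<Sum>i<Suc r. (p i (f (u, t)))\<^sup>2)"
    using sum.cartesian_product[of "\<lambda>u t. \<Sum>i<Suc r. (p i (f (u, t)))\<^sup>2" "{..<N r}" S]
    by (simp only: case_prod_unfold prod.collapse)
  also have "\<dots> = (\<Sum>u\<in>S. real (N r) * (\<Sum>i<r. (p i u)\<^sup>2)
      + (g r)\<^sup>2 * (\<Sum>t<N r. (p r u / g r + real_of_int (a u + int t))\<^sup>2))"
    by (intro sum.cong refl) (simp add: low top sum.distrib power_mult_distrib sum_distrib_left)
  also have "\<dots> \<le> (\<Sum>u\<in>S. real (N r) * (\<Sum>i<r. (p i u)\<^sup>2)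
      + (g r)\<^sup>2 * (real (N r) * ((real (N r))\<^sup>2 + 2) / 12))"
    by (intro sum_mono add_left_mono mult_left_mono a) simp
  also have "\<dots> = real (N r) * (\<Sum>u\<in>S. \<Sum>i<r. (p i u)\<^sup>2)
      + real (card S) * ((g r)\<^sup>2 * (real (N r) * ((real (N r))\<^sup>2 + 2) / 12))"
    by (simp add: sum.distrib sum_distrib_left)
  also have "\<dots> \<le> real (N r) * (real (card S) * (\<Sum>i<r. (g i)\<^sup>2 * ((real (N i))\<^sup>2 + 2) / 12))
      + real (card S) * ((g r)\<^sup>2 * (real (N r) * ((real (N r))\<^sup>2 + 2) / 12))"
    by (intro add_right_mono mult_left_mono sumS) simp
  also have "\<dots> = real (card S * N r) * (\<Sum>i<Suc r. (g i)\<^sup>2 * ((real (N i))\<^sup>2 + 2) / 12)"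
    by (simp add: algebra_simps)
  finally have sum: "(\<Sum>u\<in>f ` (S \<times> {..<N r}). \<Sum>i<Suc r. (p i u)\<^sup>2)
      \<le> real (card S * N r) * (\<Sum>i<Suc r. (g i)\<^sup>2 * ((real (N i))\<^sup>2 + 2) / 12)" .
  have card: "card (f ` (S \<times> {..<N r})) = card S * N r"
    using card_image[OF inj] by (simp add: card_cartesian_product)
  show ?case
  proof (intro exI conjI)
    show "finite (f ` (S \<times> {..<N r}))" using S(1) by simp
    show "card (f ` (S \<times> {..<N r})) = (\<Prod>i<Suc r. N i)" by (simp add: card S(2))
    show "\<forall>u\<in>f ` (S \<times> {..<N r}). \<forall>j\<ge>Suc r. u j = 0" using S(3) by (auto simp: f_def)
  qed (use sum in \<open>unfold card\<close>)
qed

text \<open>Expanding the squares and dropping the square of the sum of all points, the squared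
  distances over ordered pairs add up to at most \<open>2 * card T\<close> times the sum of squared
  norms. The \<open>card T * (card T - 1)\<close> pairs of distinct points contribute at least
  \<open>D\<close> each.\<close>

lemma separated_sum_squares:
  fixes q :: "nat \<Rightarrow> 'a \<Rightarrow> real"
  assumes T: "finite T" "T \<noteq> {}"
    and sep: "\<And>u v. u \<in> T \<Longrightarrow> v \<in> T \<Longrightarrow> u \<noteq> v \<Longrightarrow> D \<le> (\<Sum>i<r. (q i u - q i v)\<^sup>2)"
  shows "(real (card T) - 1) * D \<le> 2 * (\<Sum>u\<in>T. \<Sum>i<r. (q i u)\<^sup>2)"
proof -
  let ?c = "real (card T)"
  have c: "?c > 0" using T by (simp add: card_gt_0_iff)
  have pairs: "(\<Sum>u\<in>T. \<Sum>v\<in>T. (q i u - q i v)\<^sup>2) \<le> 2 * ?c * (\<Sum>u\<in>T. (q i u)\<^sup>2)" for i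
  proof -
    have "(\<Sum>u\<in>T. \<Sum>v\<in>T. (q i u - q i v)\<^sup>2)
        = (\<Sum>u\<in>T. \<Sum>v\<in>T. (q i u)\<^sup>2 + (q i v)\<^sup>2 - 2 * (q i u * q i v))"
      by (intro sum.cong refl) (simp add: power2_eq_square algebra_simps)
    also have "\<dots> = 2 * ?c * (\<Sum>u\<in>T. (q i u)\<^sup>2) - 2 * (\<Sum>u\<in>T. \<Sum>v\<in>T. q i u * q i v)"
      by (simp add: sum_subtractf sum.distrib sum_distrib_left mult.assoc)
    also have "(\<Sum>u\<in>T. \<Sum>v\<in>T. q i u * q i v) = (\<Sum>u\<in>T. q i u)\<^sup>2"
      by (simp add: power2_eq_square sum_product)
    finally show ?thesis by simp
  qed
  have "?c * ((?c - 1) * D) = (\<Sum>u\<in>T. \<Sum>v\<in>T - {u}. D)"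
    using T by (simp add: card_Diff_singleton of_nat_diff card_gt_0_iff Suc_leI)
  also have "\<dots> \<le> (\<Sum>u\<in>T. \<Sum>v\<in>T - {u}. \<Sum>i<r. (q i u - q i v)\<^sup>2)"
    by (intro sum_mono sep) auto
  also have "\<dots> \<le> (\<Sum>u\<in>T. \<Sum>v\<in>T. \<Sum>i<r. (q i u - q i v)\<^sup>2)"
    using T by (intro sum_mono sum_mono2) (auto intro: sum_nonneg)
  also have "\<dots> = (\<Sum>u\<in>T. \<Sum>i<r. \<Sum>v\<in>T. (q i u - q i v)\<^sup>2)"
    by (intro sum.cong refl sum.swap)
  also have "\<dots> = (\<Sum>i<r. \<Sum>u\<in>T. \<Sum>v\<in>T. (q i u - q i v)\<^sup>2)"
    by (rule sum.swap)
  also have "\<dots> \<le> (\<Sum>i<r. 2 * ?c * (\<Sum>u\<in>T. (q i u)\<^sup>2))"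
    by (intro sum_mono pairs)
  also have "\<dots> = 2 * ?c * (\<Sum>u\<in>T. \<Sum>i<r. (q i u)\<^sup>2)"
    by (subst sum.swap) (simp add: sum_distrib_left)
  finally show ?thesis
    using c by (simp add: mult.assoc mult_le_cancel_left_pos mult.left_commute)
qed

text \<open>Two different points of \<open>S\<close> in one class modulo \<open>K\<close> differ by
  \<open>K\<close> times a nonzero lattice point, so their squared distance is at least
  \<open>K^2 * D\<close>. The bound for separated points is applied in each class and summed; every
  class costs one point, and there are at most \<open>K ^ r\<close> classes.\<close>

lemma residue_classes_sum_squares:
  fixes p :: "nat \<Rightarrow> (nat \<Rightarrow> int) \<Rightarrow> real"
  assumes add: "\<And>i u v. i < r \<Longrightarrow> p i (\<lambda>j. u j - v j) = p i u - p i v"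
    and min: "\<And>u. \<exists>j<r. u j \<noteq> 0 \<Longrightarrow> D \<le> (\<Sum>i<r. (p i u)\<^sup>2)"
    and scale: "\<And>i u. i < r \<Longrightarrow> p i (\<lambda>j. int K * u j) = real K * p i u"
    and D: "0 \<le> D" and K: "0 < K"
    and S: "finite S" "\<forall>u\<in>S. \<forall>j\<ge>r. u j = 0"
  shows "(real (card S) - real (K ^ r)) * ((real K)\<^sup>2 * D) \<le> 2 * (\<Sum>u\<in>S. \<Sum>i<r. (p i u)\<^sup>2)"
proof -
  define c where "c = (\<lambda>u :: nat \<Rightarrow> int. \<lambda>i\<in>{..<r}. u i mod int K)"
  have D': "0 \<le> (real K)\<^sup>2 * D" using D by simp
  have "c ` S \<subseteq> PiE {..<r} (\<lambda>_. {0..<int K})"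
    using K by (auto simp: c_def PiE_def extensional_def)
  then have "card (c ` S) \<le> card (PiE {..<r} (\<lambda>_. {0..<int K}))"
    by (intro card_mono finite_PiE) auto
  then have classes: "card (c ` S) \<le> K ^ r"
    by (simp add: card_PiE)
  have sep: "(real K)\<^sup>2 * D \<le> (\<Sum>i<r. (p i u - p i v)\<^sup>2)"
    if uv: "u \<in> S" "v \<in> S" "c u = c v" "u \<noteq> v" for u v
  proof -
    define x where "x = (\<lambda>j. (u j - v j) div int K)"
    have mod: "u j mod int K = v j mod int K" for j
      using fun_cong[OF uv(3), of j] bspec[OF S(2) uv(1)] bspec[OF S(2) uv(2)]
      by (cases "j < r") (simp_all add: c_def)
    have Kx: "(\<lambda>j. u j - v j) = (\<lambda>j. int K * x j)"
      unfolding x_def using mod by (auto simp: fun_eq_iff mod_eq_dvd_iff)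
    obtain j where j: "u j \<noteq> v j" using uv(4) by auto
    then have "j < r" using S(2) uv(1,2) by (metis not_le)
    moreover have "x j \<noteq> 0" using fun_cong[OF Kx, of j] j by auto
    ultimately have "D \<le> (\<Sum>i<r. (p i x)\<^sup>2)" by (intro min) auto
    then have "(real K)\<^sup>2 * D \<le> (real K)\<^sup>2 * (\<Sum>i<r. (p i x)\<^sup>2)"
      by (intro mult_left_mono) auto
    also have "\<dots> = (\<Sum>i<r. (p i (\<lambda>j. u j - v j))\<^sup>2)"
      unfolding Kx by (simp add: scale sum_distrib_left power_mult_distrib)
    also have "\<dots> = (\<Sum>i<r. (p i u - p i v)\<^sup>2)"
      by (simp add: add)
    finally show ?thesis .
  qed
  have "real (card S) = (\<Sum>y\<in>c ` S. real (card {u \<in> S. c u = y}))"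
    using sum.image_gen[OF S(1), of "\<lambda>_. 1 :: real" c] by simp
  then have "(real (card S) - real (card (c ` S))) * ((real K)\<^sup>2 * D)
      = (\<Sum>y\<in>c ` S. (real (card {u \<in> S. c u = y}) - 1) * ((real K)\<^sup>2 * D))"
    by (simp add: sum_subtractf sum_distrib_right left_diff_distrib)
  also have "\<dots> \<le> (\<Sum>y\<in>c ` S. 2 * (\<Sum>u\<in>{u \<in> S. c u = y}. \<Sum>i<r. (p i u)\<^sup>2))"
    using S(1) by (intro sum_mono separated_sum_squares) (auto intro!: sep)
  also have "\<dots> = 2 * (\<Sum>u\<in>S. \<Sum>i<r. (p i u)\<^sup>2)"
    by (subst sum.image_gen[OF S(1), of _ c]) (simp add: sum_distrib_left)
  finally have "(real (card S) - real (card (c ` S))) * ((real K)\<^sup>2 * D)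
      \<le> 2 * (\<Sum>u\<in>S. \<Sum>i<r. (p i u)\<^sup>2)" .
  moreover have "(real (card S) - real (K ^ r)) * ((real K)\<^sup>2 * D)
      \<le> (real (card S) - real (card (c ` S))) * ((real K)\<^sup>2 * D)"
    using classes D' by (intro mult_right_mono) (auto simp del: of_nat_power)
  ultimately show ?thesis by linarith
qed

lemma additive_scale:
  fixes f :: "(nat \<Rightarrow> int) \<Rightarrow> real"
  assumes add: "\<And>u v. f (\<lambda>j. u j - v j) = f u - f v"
  shows "f (\<lambda>j. int K * u j) = real K * f u"
proof (induction K)
  case 0
  have "f (\<lambda>j. u j - u j) = 0" by (simp only: add)
  then show ?case by simp
next
  case (Suc K)
  have "f (\<lambda>j. int (Suc K) * u j - int K * u j) = f (\<lambda>j. int (Suc K) * u j) - f (\<lambda>j. int K * u j)"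
    by (rule add)
  moreover have "(\<lambda>j. int (Suc K) * u j - int K * u j) = u"
    by (simp add: algebra_simps)
  ultimately show ?case using Suc by (simp add: algebra_simps)
qed

text \<open>
  For the lattice whose points have coordinates \<open>p i u\<close>, average over the translates of a cube of
  volume \<open>s\<^sup>r\<close>, at least twice the determinant: some translate contains enough lattice points that two
  of them are close.  The averaging is discrete: each residue class modulo \<open>K\<close> of a set of integer
  points of a box scaled by \<open>K\<close> is a scaled translate of such a configuration, and \<open>K\<close> tends to
  infinity.
\<close>

theorem blichfeldt_cube:
  fixes p :: "nat \<Rightarrow> (nat \<Rightarrow> int) \<Rightarrow> real" and g :: "nat \<Rightarrow> real"
  assumes add: "\<And>i u v. i < r \<Longrightarrow> p i (\<lambda>j. u j - v j) = p i u - p i v"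
    and tri: "\<And>i u. i < r \<Longrightarrow> \<forall>j<i. u j = 0 \<Longrightarrow> p i u = g i * real_of_int (u i)"
    and g: "\<And>i. i < r \<Longrightarrow> 0 < g i"
    and min: "\<And>u. \<exists>j<r. u j \<noteq> 0 \<Longrightarrow> D \<le> (\<Sum>i<r. (p i u)\<^sup>2)"
    and D: "0 \<le> D" and s: "0 < s" "2 * (\<Prod>i<r. g i) \<le> s ^ r"
  shows "D \<le> real r * s\<^sup>2 / 3"
proof -
  have bound: "D \<le> (\<Sum>i<r. (s + g i / real (Suc k))\<^sup>2 + 2 * (g i / real (Suc k))\<^sup>2) / 3" for k
  proof -
    define K where "K = Suc k"
    have K: "0 < K" by (simp add: K_def)
    \<comment> \<open>The sides \<open>g i * N i\<close> of the box are just above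
      \<open>s * K\<close>, so it holds at least \<open>(s * K) ^ r\<close> divided by the product
      of the \<open>g i\<close> points, which is at least \<open>2 * K ^ r\<close> by the choice of
      \<open>s\<close>.\<close>
    define N where "N = (\<lambda>i. nat \<lceil>s * real K / g i\<rceil>)"
    have N: "s * real K / g i \<le> real (N i)" "real (N i) < s * real K / g i + 1" if "i < r" for i
    proof -
      have "0 < s * real K / g i" using s K g[OF that] by simp
      then have "real (N i) = real_of_int \<lceil>s * real K / g i\<rceil>"
        unfolding N_def by (subst of_nat_nat) linarith+
      then show "s * real K / g i \<le> real (N i)" "real (N i) < s * real K / g i + 1"
        by linarith+
    qed
    obtain S where S: "finite S" "card S = (\<Prod>i<r. N i)" "\<forall>u\<in>S. \<forall>j\<ge>r. u j = 0"
      and sumS: "(\<Sum>u\<in>S. \<Sum>i<r. (p i u)\<^sup>2)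
        \<le> real (card S) * (\<Sum>i<r. (g i)\<^sup>2 * ((real (N i))\<^sup>2 + 2) / 12)"
      using triangular_box[of r p g N, OF add tri g] by blast
    let ?c = "real (card S)" and ?Q = "\<Sum>i<r. (g i)\<^sup>2 * ((real (N i))\<^sup>2 + 2) / 12"
    have "(s * real K) ^ r / (\<Prod>i<r. g i) = (\<Prod>i<r. s * real K / g i)"
      by (simp add: prod_dividef)
    also have "\<dots> \<le> (\<Prod>i<r. real (N i))"
      using s K g N by (intro prod_mono) (auto intro: less_imp_le)
    finally have c: "(s * real K) ^ r / (\<Prod>i<r. g i) \<le> ?c"
      by (simp add: S(2))
    have P: "0 < (\<Prod>i<r. g i)" using g by (intro prod_pos) auto
    have "2 * real (K ^ r) = (2 * (\<Prod>i<r. g i)) * real K ^ r / (\<Prod>i<r. g i)"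
      unfolding eq_divide_eq using less_imp_neq[OF P] by simp
    also have "\<dots> \<le> s ^ r * real K ^ r / (\<Prod>i<r. g i)"
      using P s by (intro divide_right_mono mult_right_mono) auto
    finally have c2: "2 * real (K ^ r) \<le> ?c"
      using c by (simp add: power_mult_distrib)
    have cpos: "0 < ?c" using c2 K by (metis less_le_trans mult_pos_pos of_nat_0_less_iff zero_less_numeral zero_less_power)
    \<comment> \<open>Since \<open>card S\<close> is at least \<open>2 * K ^ r\<close>, giving up
      one point per residue class leaves at least half of them.\<close>
    have "?c / 2 * ((real K)\<^sup>2 * D) \<le> (?c - real (K ^ r)) * ((real K)\<^sup>2 * D)"
      using c2 D by (intro mult_right_mono) (auto simp del: of_nat_power)
    also have "\<dots> \<le> 2 * (\<Sum>u\<in>S. \<Sum>i<r. (p i u)\<^sup>2)"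
      by (rule residue_classes_sum_squares[OF add min _ D K S(1,3)])
        (auto intro!: additive_scale add)
    also have "\<dots> \<le> 2 * (?c * ?Q)"
      using sumS by simp
    finally have "(real K)\<^sup>2 * D \<le> 4 * ?Q"
      using cpos by (simp add: mult.assoc mult.left_commute[of _ ?c] pos_le_divide_eq)
    then have "D \<le> 4 * ?Q / (real K)\<^sup>2"
      using K by (simp add: field_simps)
    also have "\<dots> = (\<Sum>i<r. (g i * real (N i) / real K)\<^sup>2 + 2 * (g i / real K)\<^sup>2) / 3"
      by (simp add: sum_distrib_left sum_divide_distrib power_mult_distrib power_divide
          algebra_simps add_divide_distrib)
    also have "\<dots> \<le> (\<Sum>i<r. (s + g i / real K)\<^sup>2 + 2 * (g i / real K)\<^sup>2) / 3"
    proof (intro divide_right_mono sum_mono add_right_mono power_mono)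
      fix i assume "i \<in> {..<r}"
      then have i: "i < r" by simp
      have "g i * real (N i) \<le> g i * (s * real K / g i + 1)"
        using N[OF i] g[OF i] by (intro mult_left_mono) auto
      also have "\<dots> = s * real K + g i"
        using g[OF i] by (simp add: field_simps)
      finally show "g i * real (N i) / real K \<le> s + g i / real K"
        using g[OF i] K by (simp add: field_simps)
      show "0 \<le> g i * real (N i) / real K"
        using g[OF i] by simp
    qed simp
    finally show ?thesis unfolding K_def .
  qed
  \<comment> \<open>Rounding up \<open>N i\<close> and the discrete variance cost only terms in
    \<open>g i / K\<close>, which vanish as \<open>K\<close> grows.\<close>
  have "(\<lambda>k. (\<Sum>i<r. (s + g i / real (Suc k))\<^sup>2 + 2 * (g i / real (Suc k))\<^sup>2) / 3)
      \<longlonglongrightarrow> (\<Sum>i<r. (s + 0)\<^sup>2 + 2 * 0\<^sup>2) / 3"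
    by (intro tendsto_intros LIMSEQ_Suc lim_const_over_n) simp
  then have "D \<le> (\<Sum>i<r. (s + 0)\<^sup>2 + 2 * 0\<^sup>2) / 3"
    by (rule LIMSEQ_le_const) (intro exI allI impI bound)
  then show ?thesis by simp
qed

section \<open>Gram-Schmidt vectors and projected vectors\<close>

text \<open>Linear combinations are described entry by entry and used weakly, through scalar
  products with a test vector \<open>w\<close>. The expansions below all have this weak
  form.\<close>

lemma combination_scalar_prod:
  fixes e :: "'a \<Rightarrow> real vec"
  assumes "finite J" and e: "\<And>j. j \<in> J \<Longrightarrow> e j \<in> carrier_vec d" and w: "w \<in> carrier_vec d"
    and v: "\<And>t. t < d \<Longrightarrow> v $ t = (\<Sum>j\<in>J. c j * e j $ t)"
  shows "v \<bullet> w = (\<Sum>j\<in>J. c j * (e j \<bullet> w))"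
proof -
  have "v \<bullet> w = (\<Sum>t<d. \<Sum>j\<in>J. c j * e j $ t * w $ t)"
    using w v by (simp add: scalar_prod_def sum_distrib_right atLeast0LessThan)
  also have "\<dots> = (\<Sum>j\<in>J. \<Sum>t<d. c j * e j $ t * w $ t)"
    by (rule sum.swap)
  also have "\<dots> = (\<Sum>j\<in>J. c j * (e j \<bullet> w))"
    using w e by (intro sum.cong refl)
      (simp add: scalar_prod_def sum_distrib_left atLeast0LessThan mult.assoc)
  finally show ?thesis .
qed

text \<open>Parseval's identity for an orthogonal family that is not normalized. Pairing
  \<open>comb\<close> with \<open>e j\<close> identifies \<open>c j\<close>; the equivalence
  \<open>orth\<close> also makes each \<open>e j \<bullet> e j\<close> nonzero.\<close>

lemma orthogonal_combination_norm:
  fixes e :: "'a \<Rightarrow> real vec"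
  assumes J: "finite J" and e: "\<And>j. j \<in> J \<Longrightarrow> e j \<in> carrier_vec d" and y: "y \<in> carrier_vec d"
    and orth: "\<And>i j. i \<in> J \<Longrightarrow> j \<in> J \<Longrightarrow> e i \<bullet> e j = 0 \<longleftrightarrow> i \<noteq> j"
    and comb: "\<And>w. w \<in> carrier_vec d \<Longrightarrow> y \<bullet> w = (\<Sum>j\<in>J. c j * (e j \<bullet> w))"
  shows "y \<bullet> y = (\<Sum>j\<in>J. (y \<bullet> e j)\<^sup>2 / (e j \<bullet> e j))"
proof -
  have c: "y \<bullet> e j = c j * (e j \<bullet> e j)" if "j \<in> J" for j
  proof -
    have "y \<bullet> e j = (\<Sum>i\<in>J. if i = j then c j * (e j \<bullet> e j) else 0)"
      unfolding comb[OF e[OF that]] using that by (intro sum.cong refl) (auto simp: orth)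
    then show ?thesis using that J by simp
  qed
  have "y \<bullet> y = (\<Sum>j\<in>J. c j * (y \<bullet> e j))"
    unfolding comb[OF y] using e y by (intro sum.cong refl) (simp add: comm_scalar_prod[of _ d])
  also have "\<dots> = (\<Sum>j\<in>J. (y \<bullet> e j)\<^sup>2 / (e j \<bullet> e j))"
    by (intro sum.cong refl) (use orth in \<open>auto simp: c power2_eq_square\<close>)
  finally show ?thesis .
qed

lemma vec_norm_square: "(vec_norm v)\<^sup>2 = v \<bullet> v"
  unfolding vec_norm_def by (rule real_sqrt_pow2) (auto simp: scalar_prod_def intro!: sum_nonneg)

lemma vec_norm_nonneg [simp]: "0 \<le> vec_norm v"
  unfolding vec_norm_def by (auto simp: scalar_prod_def intro!: sum_nonneg)

lemma lattice_gen_combination: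
  assumes "set bs \<subseteq> carrier_vec d"
  shows "lattice_gen d bs =
    range (\<lambda>c :: nat \<Rightarrow> int. vec d (\<lambda>t. \<Sum>l<length bs. real_of_int (c l) * bs ! l $ t))"
proof -
  interpret vec_module "TYPE(real)" d .
  have "sumlist (map (\<lambda>i. of_int (c i) \<cdot>\<^sub>v bs ! i) [0..<length bs])
      = vec d (\<lambda>t. \<Sum>l<length bs. real_of_int (c l) * bs ! l $ t)" for c
  proof -
    have car: "x \<in> carrier_vec d" if "x \<in> set (map (\<lambda>i. of_int (c i) \<cdot>\<^sub>v bs ! i) [0..<length bs])" for x
      using that assms nth_mem by fastforce
    have "dim_vec (bs ! l) = d" if "l < length bs" for l
      using assms that nth_mem by fastforce
    then have "sumlist (map (\<lambda>i. of_int (c i) \<cdot>\<^sub>v bs ! i) [0..<length bs]) $ t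
        = (\<Sum>l<length bs. real_of_int (c l) * bs ! l $ t)" if "t < d" for t
      using that by (subst sumlist_vec_index[OF car])
        (auto simp: o_def interv_sum_list_conv_sum_set_nat atLeast0LessThan intro!: sum.cong)
    moreover have "dim_vec (sumlist (map (\<lambda>i. of_int (c i) \<cdot>\<^sub>v bs ! i) [0..<length bs])) = d"
      by (rule sumlist_dim[OF car])
    ultimately show ?thesis
      by (intro eq_vecI) simp_all
  qed
  then show ?thesis unfolding lattice_of_def by simp
qed

section \<open>Unfolding the Gram-Schmidt recursion\<close>

lemma adjuster_scalar_prod:
  fixes w :: "real vec"
  assumes "set us \<subseteq> carrier_vec d" "v \<in> carrier_vec d"
  shows "adjuster d w us \<bullet> v = (\<Sum>u\<leftarrow>us. - (w \<bullet>c u) / (u \<bullet>c u) * (u \<bullet> v))"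
    and "adjuster d w us \<in> carrier_vec d"
proof -
  have "adjuster d w us \<in> carrier_vec d \<and>
      adjuster d w us \<bullet> v = (\<Sum>u\<leftarrow>us. - (w \<bullet>c u) / (u \<bullet>c u) * (u \<bullet> v))"
    using assms
  proof (induction us)
    case (Cons u us)
    then show ?case
      by (auto simp: add_scalar_prod_distrib[of _ d])
  qed simp
  then show "adjuster d w us \<bullet> v = (\<Sum>u\<leftarrow>us. - (w \<bullet>c u) / (u \<bullet>c u) * (u \<bullet> v))"
    and "adjuster d w us \<in> carrier_vec d" by auto
qed

text \<open>The accumulator carries the vectors already produced, latest first, hence
  \<open>rev\<close>.\<close>

lemma gram_schmidt_sub2_nth:
  "i < length ws \<Longrightarrow> gram_schmidt_sub2 d us ws ! i =
     adjuster d (ws ! i) (rev (take i (gram_schmidt_sub2 d us ws)) @ us) + ws ! i"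
proof (induction ws arbitrary: us i)
  case (Cons w ws)
  then show ?case
    by (cases i) (simp_all add: Let_def)
qed simp

lemma gram_schmidt_basis:
  assumes "lin_indpt_list d bs"
  shows "LinearCombinations.module.span class_ring (module_vec TYPE(real) d) (set bs)
      = LinearCombinations.module.span class_ring (module_vec TYPE(real) d) (set (gram_schmidt d bs))"
    and "\<And>i j. i < length bs \<Longrightarrow> j < length bs \<Longrightarrow> gs_vec d bs i \<bullet> gs_vec d bs j = 0 \<longleftrightarrow> i \<noteq> j"
    and "\<And>i. i < length bs \<Longrightarrow> gs_vec d bs i \<in> carrier_vec d"
    and "length (gram_schmidt d bs) = length bs"
proof -
  interpret cof_vec_space d "TYPE(real)" .
  have bs: "set bs \<subseteq> carrier_vec d" "distinct bs" "\<not> lin_dep (set bs)"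
    using assms by (auto simp: lin_indpt_list_def)
  note gs = gram_schmidt_result[OF bs refl]
  show "span (set bs) = span (set (gram_schmidt d bs))" by (rule gs(1))
  show len: "length (gram_schmidt d bs) = length bs" by (rule gs(4))
  show "gs_vec d bs i \<in> carrier_vec d" if "i < length bs" for i
    using that gs(3) len unfolding gs_vec_def by auto
  show "gs_vec d bs i \<bullet> gs_vec d bs j = 0 \<longleftrightarrow> i \<noteq> j" if "i < length bs" "j < length bs" for i j
    using corthogonalD[OF gs(2), of i j] that len unfolding gs_vec_def
    by simp
qed

text \<open>One step of the recursion: the adjuster is minus the projection of \<open>bs ! i\<close>
  onto the earlier Gram-Schmidt vectors, with the coefficients \<open>gs_coeff\<close>.\<close>

lemma gs_vec_expansion:
  assumes ind: "lin_indpt_list d bs" and i: "i < length bs" and w: "w \<in> carrier_vec d"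
  shows "bs ! i \<bullet> w = gs_vec d bs i \<bullet> w + (\<Sum>j<i. gs_coeff d bs i j * (gs_vec d bs j \<bullet> w))"
proof -
  let ?G = "gram_schmidt d bs"
  note gs = gram_schmidt_basis[OF ind]
  have bi: "bs ! i \<in> carrier_vec d"
    using ind i by (auto simp: lin_indpt_list_def)
  have car: "set (rev (take i ?G)) \<subseteq> carrier_vec d"
    using gs(3,4) by (fastforce simp: gs_vec_def in_set_conv_nth)
  have "gs_vec d bs i = adjuster d (bs ! i) (rev (take i ?G)) + bs ! i"
    using gram_schmidt_sub2_nth[OF i, of d "[]"] unfolding gs_vec_def gram_schmidt_code by simp
  then have "gs_vec d bs i \<bullet> w =
      (\<Sum>u\<leftarrow>rev (take i ?G). - (bs ! i \<bullet>c u) / (u \<bullet>c u) * (u \<bullet> w)) + bs ! i \<bullet> w"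
    using adjuster_scalar_prod[OF car w] by (simp add: add_scalar_prod_distrib[OF _ bi w])
  also have "(\<Sum>u\<leftarrow>rev (take i ?G). - (bs ! i \<bullet>c u) / (u \<bullet>c u) * (u \<bullet> w))
      = (\<Sum>u\<leftarrow>take i ?G. - (bs ! i \<bullet>c u) / (u \<bullet>c u) * (u \<bullet> w))"
    by (simp add: rev_map[symmetric] sum_list_rev)
  also have "\<dots> = (\<Sum>j<i. - gs_coeff d bs i j * (gs_vec d bs j \<bullet> w))"
    using i gs(4) by (simp add: sum_list_sum_nth atLeast0LessThan gs_coeff_def gs_vec_def vec_norm_square
        cong: sum.cong_simp)
  finally show ?thesis by (simp add: sum_negf)
qed

lemma proj_vec_scalar_prod:
  assumes ind: "lin_indpt_list d bs" and i: "i < length bs" and w: "w \<in> carrier_vec d"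
  shows "proj_vec d bs k i \<bullet> w
      = gs_vec d bs i \<bullet> w + (\<Sum>j\<in>{k..<i}. gs_coeff d bs i j * (gs_vec d bs j \<bullet> w))"
    and "proj_vec d bs k i \<in> carrier_vec d"
proof -
  note gs = gram_schmidt_basis[OF ind]
  let ?F = "finsum_vec TYPE(real) d (\<lambda>j. gs_coeff d bs i j \<cdot>\<^sub>v gs_vec d bs j) {k..<i}"
  have car: "gs_vec d bs j \<in> carrier_vec d" if "j \<le> i" for j
    using gs(3) that i by auto
  have F: "?F \<in> carrier_vec d"
    by (rule finsum_vec_closed) (use car in auto)
  have "?F \<bullet> w = (\<Sum>j\<in>{k..<i}. gs_coeff d bs i j * (gs_vec d bs j \<bullet> w))"
  proof (rule combination_scalar_prod[where d = d])
    fix t assume "t < d"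
    then have "?F $ t = (\<Sum>j\<in>{k..<i}. (gs_coeff d bs i j \<cdot>\<^sub>v gs_vec d bs j) $ t)"
      by (intro index_finsum_vec) (use car in auto)
    also have "\<dots> = (\<Sum>j\<in>{k..<i}. gs_coeff d bs i j * gs_vec d bs j $ t)"
      using carrier_vecD[OF car] \<open>t < d\<close> by (intro sum.cong refl) auto
    finally show "?F $ t = (\<Sum>j\<in>{k..<i}. gs_coeff d bs i j * gs_vec d bs j $ t)" .
  qed (use car w in auto)
  then show "proj_vec d bs k i \<bullet> w
      = gs_vec d bs i \<bullet> w + (\<Sum>j\<in>{k..<i}. gs_coeff d bs i j * (gs_vec d bs j \<bullet> w))"
    unfolding proj_vec_def using add_scalar_prod_distrib[OF car[OF order_refl] F w] by simp
  show "proj_vec d bs k i \<in> carrier_vec d"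
    unfolding proj_vec_def using car[OF order_refl] F by simp
qed

lemmas proj_vec_carrier = proj_vec_scalar_prod(2)[OF _ _ zero_carrier_vec]

section \<open>Reciprocal bases\<close>

text \<open>Padding the coefficients by zeros beyond \<open>i\<close> expands all projected vectors
  in one common family, from \<open>k\<close> to the end; the coefficient matrix is then triangular
  with unit diagonal.\<close>

lemma proj_vec_expansion:
  assumes ind: "lin_indpt_list d bs" and i: "i < length bs" "k \<le> i"
  shows "\<exists>c. c i = 1 \<and> (\<forall>h>i. c h = 0) \<and>
    (\<forall>w\<in>carrier_vec d. proj_vec d bs k i \<bullet> w = (\<Sum>h\<in>{k..<length bs}. c h * (gs_vec d bs h \<bullet> w)))"
proof (intro exI conjI ballI)
  let ?c = "\<lambda>h. if h < i then gs_coeff d bs i h else if h = i then 1 else 0"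
  show "?c i = 1" "\<forall>h>i. ?c h = 0" by auto
  fix w :: "real vec" assume w: "w \<in> carrier_vec d"
  have "(\<Sum>h\<in>{k..<length bs}. ?c h * (gs_vec d bs h \<bullet> w))
      = (\<Sum>h\<in>{k..<Suc i}. ?c h * (gs_vec d bs h \<bullet> w))"
    using i by (intro sum.mono_neutral_right) auto
  also have "\<dots> = (\<Sum>h\<in>{k..<i}. gs_coeff d bs i h * (gs_vec d bs h \<bullet> w)) + gs_vec d bs i \<bullet> w"
    using i by (simp add: sum.atLeastLessThan_Suc)
  finally show "proj_vec d bs k i \<bullet> w = (\<Sum>h\<in>{k..<length bs}. ?c h * (gs_vec d bs h \<bullet> w))"
    using proj_vec_scalar_prod(1)[OF ind i(1) w, of k] by simp
qed

lemma gs_vec_norm_pos: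
  assumes "lin_indpt_list d bs" "i < length bs"
  shows "0 < vec_norm (gs_vec d bs i)"
proof -
  have "gs_vec d bs i \<bullet> gs_vec d bs i \<noteq> 0"
    using gram_schmidt_basis(2)[OF assms(1) assms(2) assms(2)] by simp
  then have "vec_norm (gs_vec d bs i) \<noteq> 0"
    using vec_norm_square[of "gs_vec d bs i"] by auto
  then show ?thesis
    using vec_norm_nonneg[of "gs_vec d bs i"] by linarith
qed

text \<open>KZ reducedness makes the Gram-Schmidt vector at \<open>k = length bs - q\<close> a
  shortest vector of the lattice projected at \<open>k\<close>, whose determinant is the product of
  the last \<open>q\<close> Gram-Schmidt norms. Coordinates along the normalized Gram-Schmidt
  vectors are triangular when read from the last one backwards, so \<open>blichfeldt_cube\<close>
  applies.\<close>

lemma KZ_first_vector_bound: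
  assumes KZ: "KZ_reduced_basis d bs L" and q: "q \<le> length bs" "0 < q"
    and s: "0 < s" "2 * (\<Prod>i<q. vec_norm (gs_vec d bs (length bs - 1 - i))) \<le> s ^ q"
  shows "(vec_norm (gs_vec d bs (length bs - q)))\<^sup>2 \<le> real q * s\<^sup>2 / 3"
proof -
  define r where "r = length bs"
  define k where "k = r - q"
  let ?e = "gs_vec d bs"
  have ind: "lin_indpt_list d bs"
    and short: "\<And>i. i < r \<Longrightarrow> shortest_nonzero d (proj_lattice d bs i) (proj_vec d bs i i)"
    using KZ by (auto simp: KZ_reduced_basis_def lattice_basis_def r_def)
  note gs = gram_schmidt_basis[OF ind, folded r_def]
  have "\<forall>i. \<exists>c. i < r \<longrightarrow> k \<le> i \<longrightarrow> c i = 1 \<and> (\<forall>h>i. c h = 0) \<and> (\<forall>w\<in>carrier_vec d.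
      proj_vec d bs k i \<bullet> w = (\<Sum>h\<in>{k..<r}. c h * (?e h \<bullet> w)))"
    using proj_vec_expansion[OF ind, folded r_def] by (simp only: ex_simps) blast
  from choice[OF this] obtain c where c: "\<And>i. i < r \<Longrightarrow> k \<le> i \<Longrightarrow> c i i = (1::real)"
      "\<And>i h. i < r \<Longrightarrow> k \<le> i \<Longrightarrow> i < h \<Longrightarrow> c i h = 0"
      "\<And>i w. i < r \<Longrightarrow> k \<le> i \<Longrightarrow> w \<in> carrier_vec d \<Longrightarrow>
        proj_vec d bs k i \<bullet> w = (\<Sum>h\<in>{k..<r}. c i h * (?e h \<bullet> w))"
    by blast
  have car: "proj_vec d bs k i \<in> carrier_vec d" if "i < r" for i
    using proj_vec_carrier[OF ind, of i k] that unfolding r_def by simp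
  let ?ps = "map (proj_vec d bs k) [k..<r]"
  have len: "length ?ps = q"
    using q by (simp add: k_def r_def)
  have nth: "?ps ! a = proj_vec d bs k (k + a)" if "a < q" for a
    using that q by (simp add: k_def r_def)
  \<comment> \<open>Coefficients are counted from the end: the component along the last Gram-Schmidt
    vector involves only the last basis vector, so entry 0 of \<open>x\<close> has to belong to that
    one.\<close>
  define Y where "Y = (\<lambda>x :: nat \<Rightarrow> int. vec d (\<lambda>t. \<Sum>a<q. real_of_int (x (q - Suc a)) * ?ps ! a $ t))"
  have Ycar: "Y x \<in> carrier_vec d" for x
    by (simp add: Y_def)
  have "set ?ps \<subseteq> carrier_vec d" using car by auto
  then have YL: "Y x \<in> proj_lattice d bs k" for x
    unfolding proj_lattice_def r_def[symmetric]
    by (simp only: lattice_gen_combination len Y_def) (rule rangeI)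
  have Yw: "Y x \<bullet> w = (\<Sum>i<q. real_of_int (x i) * (proj_vec d bs k (r - 1 - i) \<bullet> w))"
    if w: "w \<in> carrier_vec d" for x w
  proof -
    have "Y x \<bullet> w = (\<Sum>a<q. real_of_int (x (q - Suc a)) * (?ps ! a \<bullet> w))"
    proof (rule combination_scalar_prod[where d = d])
      show "?ps ! a \<in> carrier_vec d" if "a \<in> {..<q}" for a
        using that nth[of a] car[of "k + a"] q by (simp add: k_def r_def)
    qed (use w in \<open>auto simp: Y_def\<close>)
    also have "\<dots> = (\<Sum>i<q. real_of_int (x (q - Suc (q - Suc i))) * (?ps ! (q - Suc i) \<bullet> w))"
      by (rule sum.nat_diff_reindex[symmetric])
    also have "\<dots> = (\<Sum>i<q. real_of_int (x i) * (proj_vec d bs k (r - 1 - i) \<bullet> w))"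
    proof (intro sum.cong refl)
      fix i assume "i \<in> {..<q}"
      then have i: "i < q" by simp
      have "?ps ! (q - Suc i) = proj_vec d bs k (k + (q - Suc i))"
        using i by (intro nth) simp
      moreover have "k + (q - Suc i) = r - 1 - i" "q - Suc (q - Suc i) = i"
        using i q by (auto simp: k_def r_def)
      ultimately show "real_of_int (x (q - Suc (q - Suc i))) * (?ps ! (q - Suc i) \<bullet> w)
          = real_of_int (x i) * (proj_vec d bs k (r - 1 - i) \<bullet> w)"
        by simp
    qed
    finally show ?thesis .
  qed
  have ix: "r - 1 - i < r" "k \<le> r - 1 - i" if "i < q" for i
    using that q by (auto simp: k_def r_def)
  define g where "g = (\<lambda>i. vec_norm (?e (r - 1 - i)))"
  define p where "p = (\<lambda>i x. Y x \<bullet> ?e (r - 1 - i) / g i)"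
  have gpos: "0 < g i" if "i < q" for i
    using gs_vec_norm_pos[OF ind] ix(1)[OF that] by (simp add: g_def r_def)
  have gsq: "(g i)\<^sup>2 = ?e (r - 1 - i) \<bullet> ?e (r - 1 - i)" for i
    by (simp add: g_def vec_norm_square)
  have pr: "proj_vec d bs k l \<bullet> ?e l' = (if l' = l then ?e l \<bullet> ?e l else 0)"
    if "l < r" "k \<le> l" "l \<le> l'" "l' < r" for l l'
  proof -
    have "proj_vec d bs k l \<bullet> ?e l' = (\<Sum>h\<in>{k..<r}. if h = l' then c l l' * (?e l' \<bullet> ?e l') else 0)"
      unfolding c(3)[OF that(1,2) gs(3)[OF that(4)]] using that gs(2)
      by (intro sum.cong refl) auto
    also have "\<dots> = c l l' * (?e l' \<bullet> ?e l')" using that by simp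
    also have "\<dots> = (if l' = l then ?e l \<bullet> ?e l else 0)"
      using c(1,2) that by (cases "l' = l") auto
    finally show ?thesis .
  qed
  have add: "p i (\<lambda>j. u j - v j) = p i u - p i v" if "i < q" for i u v
    using gs(3)[OF ix(1)[OF that]]
    by (simp add: p_def Yw left_diff_distrib sum_subtractf diff_divide_distrib)
  have tri: "p i u = g i * real_of_int (u i)" if i: "i < q" and u: "\<forall>j<i. u j = 0" for i u
  proof -
    have "Y u \<bullet> ?e (r - 1 - i) = (\<Sum>j<q. if j = i then real_of_int (u i) * (g i)\<^sup>2 else 0)"
      unfolding Yw[OF gs(3)[OF ix(1)[OF i]]]
    proof (intro sum.cong refl)
      fix j assume "j \<in> {..<q}"
      then have j: "j < q" by simp
      show "real_of_int (u j) * (proj_vec d bs k (r - 1 - j) \<bullet> ?e (r - 1 - i))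
          = (if j = i then real_of_int (u i) * (g i)\<^sup>2 else 0)"
      proof (cases "j < i")
        case True
        then show ?thesis using u by simp
      next
        case False
        then have "r - 1 - j \<le> r - 1 - i" "r - 1 - i = r - 1 - j \<longleftrightarrow> j = i"
          using i j q by (auto simp: r_def)
        then show ?thesis
          using pr[OF ix[OF j] _ ix(1)[OF i]] by (simp add: gsq)
      qed
    qed
    then show ?thesis
      using i gpos[OF i] by (simp add: p_def power2_eq_square)
  qed
  have norm: "(\<Sum>i<q. (p i u)\<^sup>2) = Y u \<bullet> Y u" for u
  proof -
    have "Y u \<bullet> Y u = (\<Sum>h\<in>{k..<r}. (Y u \<bullet> ?e h)\<^sup>2 / (?e h \<bullet> ?e h))"
    proof (rule orthogonal_combination_norm[where d = d])
      fix w :: "real vec" assume w: "w \<in> carrier_vec d"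
      have "Y u \<bullet> w = (\<Sum>i<q. \<Sum>h\<in>{k..<r}. real_of_int (u i) * c (r - 1 - i) h * (?e h \<bullet> w))"
        unfolding Yw[OF w] using ix w
        by (intro sum.cong refl) (simp add: c(3) sum_distrib_left mult.assoc)
      also have "\<dots> = (\<Sum>h\<in>{k..<r}. (\<Sum>i<q. real_of_int (u i) * c (r - 1 - i) h) * (?e h \<bullet> w))"
        by (subst sum.swap) (simp add: sum_distrib_right)
      finally show "Y u \<bullet> w
          = (\<Sum>h\<in>{k..<r}. (\<Sum>i<q. real_of_int (u i) * c (r - 1 - i) h) * (?e h \<bullet> w))" .
    qed (use q in \<open>simp_all add: gs(2,3) Ycar\<close>)
    also have "\<dots> = (\<Sum>i<q. (Y u \<bullet> ?e (r - 1 - i))\<^sup>2 / (?e (r - 1 - i) \<bullet> ?e (r - 1 - i)))"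
      by (rule sum.reindex_bij_witness[of _ "\<lambda>i. r - 1 - i" "\<lambda>h. r - 1 - h"])
        (use q in \<open>auto simp: k_def r_def\<close>)
    finally show ?thesis
      by (simp add: p_def power_divide gsq)
  qed
  have k: "k < r" using q by (simp add: k_def r_def)
  \<comment> \<open>The sum in \<open>proj_vec d bs k k\<close> is empty, so this vector has the
    same scalar products as the Gram-Schmidt vector.\<close>
  have first: "(vec_norm (proj_vec d bs k k))\<^sup>2 = (vec_norm (?e k))\<^sup>2"
  proof -
    have "proj_vec d bs k k \<bullet> w = ?e k \<bullet> w" if "w \<in> carrier_vec d" for w
      using proj_vec_scalar_prod(1)[OF ind, of k w k] k that by (simp add: r_def)
    then have "proj_vec d bs k k \<bullet> proj_vec d bs k k = ?e k \<bullet> ?e k"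
      using car[OF k] gs(3)[OF k] by (metis comm_scalar_prod)
    then show ?thesis by (simp add: vec_norm_square)
  qed
  have "(vec_norm (?e k))\<^sup>2 \<le> real q * s\<^sup>2 / 3"
  proof (rule blichfeldt_cube[where p = p and g = g, OF add tri gpos])
    fix u :: "nat \<Rightarrow> int" assume "\<exists>j<q. u j \<noteq> 0"
    \<comment> \<open>At the first index with \<open>u i \<noteq> 0\<close> triangularity gives
      \<open>p i u = g i * u i\<close>, so the lattice point \<open>Y u\<close> is nonzero and
      cannot beat the shortest one.\<close>
    then have "\<exists>i. (i < q \<and> u i \<noteq> 0) \<and> (\<forall>j<i. \<not> (j < q \<and> u j \<noteq> 0))"
      by (subst exists_least_iff[symmetric])
    then obtain i where i: "i < q" "u i \<noteq> 0" "\<forall>j<i. u j = 0"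
      using less_trans by blast
    have "p i u \<noteq> 0" using tri[OF i(1,3)] i(2) gpos[OF i(1)] by simp
    then have "Y u \<noteq> 0\<^sub>v d"
      using gs(3)[OF ix(1)[OF i(1)]] by (auto simp: p_def)
    then have "vec_norm (proj_vec d bs k k) \<le> vec_norm (Y u)"
      using short[OF k] YL unfolding shortest_nonzero_def by blast
    then have "(vec_norm (proj_vec d bs k k))\<^sup>2 \<le> (vec_norm (Y u))\<^sup>2"
      by (intro power_mono) auto
    then show "(vec_norm (?e k))\<^sup>2 \<le> (\<Sum>i<q. (p i u)\<^sup>2)"
      unfolding norm using first by (simp add: vec_norm_square)
  next
    show "2 * (\<Prod>i<q. g i) \<le> s ^ q"
      using s(2) unfolding g_def r_def .
  qed (simp_all add: s(1))
  then show ?thesis by (simp add: k_def r_def)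
qed

section \<open>Linear hulls and coordinates\<close>

lemma lin_hull_lattice_gen:
  assumes "set bs \<subseteq> carrier_vec d"
  shows "lin_hull d (lattice_gen d bs) \<subseteq> lin_hull d (set bs)"
proof -
  interpret vec_space "TYPE(real)" d .
  have "lattice_of bs \<subseteq> span (set bs)"
  proof
    fix x assume "x \<in> lattice_of bs"
    then obtain c where "x = sumlist (map (\<lambda>i. of_int (c i) \<cdot>\<^sub>v bs ! i) [0..<length bs])"
      by (rule in_latticeE)
    moreover have "bs ! i \<in> span (set bs)" if "i < length bs" for i
      using assms that by (intro span_mem) auto
    ultimately show "x \<in> span (set bs)"
      using assms by (auto intro!: sumlist_in_span[OF assms] smult_in_span[OF assms])
  qed
  then show ?thesis
    unfolding lin_hull_def using assms by (intro span_subsetI)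
qed

lemma lin_hull_combination:
  fixes n :: nat
  assumes S: "S \<subseteq> carrier_vec d" and f: "\<And>j. j < n \<Longrightarrow> f j \<in> lin_hull d S" and v: "v \<in> lin_hull d S"
  shows "vec d (\<lambda>t. v $ t + (\<Sum>j<n. c j * f j $ t)) \<in> lin_hull d S"
proof -
  interpret vec_space "TYPE(real)" d .
  have sc: "x \<in> carrier_vec d" if "x \<in> span S" for x
    using that span_closed[OF S] by auto
  show ?thesis
    using f
  proof (induction n)
    case 0
    have "vec d (\<lambda>t. v $ t) = v"
      using carrier_vecD[OF sc] v by (intro eq_vecI) (auto simp: lin_hull_def)
    then show ?case using v by simp
  next
    case (Suc n)
    have "vec d (\<lambda>t. v $ t + (\<Sum>j<Suc n. c j * f j $ t))
        = vec d (\<lambda>t. v $ t + (\<Sum>j<n. c j * f j $ t)) + c n \<cdot>\<^sub>v f n"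
      using carrier_vecD[OF sc, of "f n"] Suc.prems[of n] by (intro eq_vecI) (auto simp: lin_hull_def)
    then show ?case
      using span_add1[of S "vec d (\<lambda>t. v $ t + (\<Sum>j<n. c j * f j $ t))" "c n \<cdot>\<^sub>v f n"]
        S Suc smult_in_span[OF S, of "f n" "c n"]
      by (simp add: lin_hull_def)
  qed
qed

lemma lin_hull_coefficients:
  assumes bs: "set bs \<subseteq> carrier_vec d" "distinct bs" and v: "v \<in> lin_hull d (set bs)"
  shows "\<exists>a. \<forall>t<d. v $ t = (\<Sum>l<length bs. a l * bs ! l $ t)"
proof -
  interpret vec_space "TYPE(real)" d .
  obtain a where a: "v = lincomb a (set bs)"
    using v finite_span[OF finite_set bs(1)] unfolding lin_hull_def by auto
  have "v $ t = (\<Sum>l<length bs. a (bs ! l) * bs ! l $ t)" if "t < d" for t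
    unfolding a lincomb_index[OF that bs(1)]
    using sum.reindex_bij_betw[OF bij_betw_nth[OF bs(2) refl refl], of "\<lambda>x. a x * x $ t"] by simp
  then show ?thesis by (intro exI[of _ "\<lambda>l. a (bs ! l)"]) auto
qed

section \<open>Gram-Schmidt vectors of the reciprocal basis\<close>

context
  fixes d :: nat and bs bs' :: "real vec list" and r :: nat
  assumes ind: "lin_indpt_list d bs" and rec: "reciprocal_basis d bs bs'" and r: "r = length bs"
begin

lemma reciprocal_lin_indpt: "lin_indpt_list d bs'"
  and length_reciprocal: "length bs' = r"
  and reciprocal_scalar_prod:
    "\<And>i j. i < r \<Longrightarrow> j < r \<Longrightarrow> bs ! i \<bullet> bs' ! j = (if i + j + 1 = r then 1 else 0)"
  using rec by (auto simp: reciprocal_basis_def lattice_basis_def r)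

lemma reciprocal_carrier: "i < r \<Longrightarrow> bs ! i \<in> carrier_vec d" "i < r \<Longrightarrow> bs' ! i \<in> carrier_vec d"
proof -
  show "i < r \<Longrightarrow> bs ! i \<in> carrier_vec d"
    using ind by (auto simp: lin_indpt_list_def r)
  show "i < r \<Longrightarrow> bs' ! i \<in> carrier_vec d"
    using reciprocal_lin_indpt length_reciprocal by (auto simp: lin_indpt_list_def)
qed

lemmas gs' = gram_schmidt_basis[OF reciprocal_lin_indpt, unfolded length_reciprocal]

text \<open>Orthogonalization preserves biorthogonality in this range of indices:
  \<open>bs' ! t\<close> differs from its Gram-Schmidt vector by a combination of those at
  \<open>j < t\<close>, and these are orthogonal to \<open>bs ! l\<close> by induction, because
  \<open>l + j + 1 < r\<close>.\<close>

lemma gs_reciprocal_scalar_prod: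
  "l < r \<Longrightarrow> t < r \<Longrightarrow> l + t + 1 \<le> r \<Longrightarrow> gs_vec d bs' t \<bullet> bs ! l = (if l + t + 1 = r then 1 else 0)"
proof (induction t rule: less_induct)
  case (less t)
  have "bs' ! t \<bullet> bs ! l = gs_vec d bs' t \<bullet> bs ! l
      + (\<Sum>j<t. gs_coeff d bs' t j * (gs_vec d bs' j \<bullet> bs ! l))"
    using less.prems by (intro gs_vec_expansion reciprocal_lin_indpt)
      (simp_all add: length_reciprocal reciprocal_carrier)
  also have "(\<Sum>j<t. gs_coeff d bs' t j * (gs_vec d bs' j \<bullet> bs ! l)) = 0"
    using less by (intro sum.neutral) auto
  finally have "gs_vec d bs' t \<bullet> bs ! l = bs' ! t \<bullet> bs ! l" by simp
  also have "\<dots> = bs ! l \<bullet> bs' ! t"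
    using less.prems by (intro comm_scalar_prod[of _ d] reciprocal_carrier)
  finally show ?case
    using less.prems by (simp add: reciprocal_scalar_prod)
qed

text \<open>The reciprocal lattice lies in the linear hull by definition, and Gram-Schmidt preserves
  the span.\<close>

lemma gs_reciprocal_in_lin_hull:
  assumes j: "j < r"
  shows "gs_vec d bs' j \<in> lin_hull d (set bs)"
proof -
  interpret vec_space "TYPE(real)" d .
  have bs: "set bs \<subseteq> carrier_vec d" and bs': "set bs' \<subseteq> carrier_vec d"
    using ind reciprocal_lin_indpt by (auto simp: lin_indpt_list_def)
  have "set bs' \<subseteq> reciprocal_lattice d (lattice_gen d bs)"
  proof
    fix x assume "x \<in> set bs'"
    then have "x \<in> lattice_of bs'"
      using basis_in_latticeI[OF bs'] by blast
    then show "x \<in> reciprocal_lattice d (lattice_gen d bs)"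
      using rec by (simp add: reciprocal_basis_def lattice_basis_def)
  qed
  then have "set bs' \<subseteq> lin_hull d (set bs)"
    using lin_hull_lattice_gen[OF bs] by (auto simp: reciprocal_lattice_def)
  then have "span (set bs') \<subseteq> lin_hull d (set bs)"
    unfolding lin_hull_def by (intro span_subsetI bs)
  moreover have "gs_vec d bs' j \<in> span (set (gram_schmidt d bs'))"
  proof (rule span_mem)
    show "set (gram_schmidt d bs') \<subseteq> carrier_vec d"
      using gs'(3,4) by (auto simp: gs_vec_def in_set_conv_nth)
    show "gs_vec d bs' j \<in> set (gram_schmidt d bs')"
      using j gs'(4) by (simp add: gs_vec_def)
  qed
  ultimately show ?thesis using gs'(1) by auto
qed

text \<open>The remainder \<open>u\<close> of \<open>v\<close> after subtracting all projections is
  orthogonal to every Gram-Schmidt vector, hence to every reciprocal vector. As \<open>u\<close> is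
  also a combination of \<open>bs\<close>, biorthogonality makes its coefficients vanish.\<close>

lemma gs_reciprocal_expansion:
  assumes v: "v \<in> lin_hull d (set bs)" and w: "w \<in> carrier_vec d"
  shows "v \<bullet> w = (\<Sum>j<r. (v \<bullet> gs_vec d bs' j) / (gs_vec d bs' j \<bullet> gs_vec d bs' j) * (gs_vec d bs' j \<bullet> w))"
proof -
  let ?e = "gs_vec d bs'"
  define c where "c = (\<lambda>j. (v \<bullet> ?e j) / (?e j \<bullet> ?e j))"
  define u where "u = vec d (\<lambda>t. v $ t + (\<Sum>j<r. - c j * ?e j $ t))"
  have bs: "set bs \<subseteq> carrier_vec d" "distinct bs"
    using ind by (auto simp: lin_indpt_list_def)
  interpret vec_space "TYPE(real)" d .
  have vc: "v \<in> carrier_vec d"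
    using v span_closed[OF bs(1)] by (simp add: lin_hull_def)
  have u_in: "u \<in> lin_hull d (set bs)"
    unfolding u_def by (intro lin_hull_combination bs v gs_reciprocal_in_lin_hull)
  have uc: "u \<in> carrier_vec d" by (simp add: u_def)
  have uw: "u \<bullet> w = v \<bullet> w - (\<Sum>j<r. c j * (?e j \<bullet> w))" if w: "w \<in> carrier_vec d" for w
  proof -
    have "(v - u) \<bullet> w = (\<Sum>j<r. c j * (?e j \<bullet> w))"
    proof (rule combination_scalar_prod[where d = d])
      fix t assume "t < d"
      then show "(v - u) $ t = (\<Sum>j<r. c j * ?e j $ t)"
        using vc uc by (simp add: u_def sum_negf)
    qed (use gs' w in auto)
    then show ?thesis
      using minus_scalar_prod_distrib[OF vc uc w] by simp
  qed
  have ue: "?e j \<bullet> u = 0" if j: "j < r" for j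
  proof -
    have "u \<bullet> ?e j = v \<bullet> ?e j - (\<Sum>i<r. if i = j then v \<bullet> ?e j else 0)"
      unfolding uw[OF gs'(3)[OF j]] using j gs'(2)
      by (intro arg_cong2[of _ _ _ _ "(-)"] sum.cong refl) (auto simp: c_def)
    then show ?thesis
      using comm_scalar_prod[OF uc gs'(3)[OF j]] j by simp
  qed
  obtain a where a: "\<forall>t<d. u $ t = (\<Sum>l<length bs. a l * bs ! l $ t)"
    using lin_hull_coefficients[OF bs u_in] by blast
  have "a l = 0" if l: "l < r" for l
  proof -
    let ?j = "r - 1 - l"
    have j: "?j < r" using l by simp
    have "bs' ! ?j \<bullet> u = ?e ?j \<bullet> u + (\<Sum>i<?j. gs_coeff d bs' ?j i * (?e i \<bullet> u))"
      using j uc by (intro gs_vec_expansion reciprocal_lin_indpt) (simp_all add: length_reciprocal)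
    then have "bs' ! ?j \<bullet> u = 0" using ue j by simp
    then have "0 = u \<bullet> bs' ! ?j"
      using comm_scalar_prod[OF uc reciprocal_carrier(2)[OF j]] by simp
    also have "\<dots> = (\<Sum>l<r. a l * (bs ! l \<bullet> bs' ! ?j))"
      using a j by (intro combination_scalar_prod[where d = d]) (auto simp: reciprocal_carrier r[symmetric])
    also have "\<dots> = (\<Sum>l'<r. if l' = l then a l else 0)"
      using l j by (intro sum.cong refl) (auto simp: reciprocal_scalar_prod)
    also have "\<dots> = a l" using l by simp
    finally show ?thesis by simp
  qed
  then have "u = 0\<^sub>v d"
    using a uc by (intro eq_vecI) (auto simp: r)
  then show ?thesis using uw[OF w] w by (simp add: c_def)
qed

text \<open>The first \<open>q\<close> basis vectors are orthogonal to the Gram-Schmidt vectors of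
  \<open>bs'\<close> before \<open>r - q\<close>. Along the remaining ones, normalized, their
  coordinates are triangular with the inverse norms as diagonal. So the lattice they generate has
  the inverse of the determinant of the projected reciprocal lattice, and
  \<open>blichfeldt_cube\<close> applies to it.\<close>

lemma sublattice_shortest_vector_bound:
  assumes q: "q \<le> r" "0 < q" and D: "0 \<le> D"
    and min: "\<And>v. v \<in> lattice_gen d bs \<Longrightarrow> v \<noteq> 0\<^sub>v d \<Longrightarrow> D \<le> v \<bullet> v"
    and s: "0 < s" "2 * (\<Prod>j<q. 1 / vec_norm (gs_vec d bs' (r - q + j))) \<le> s ^ q"
  shows "D \<le> real q * s\<^sup>2 / 3"
proof -
  let ?e = "gs_vec d bs'"
  define k where "k = r - q"
  \<comment> \<open>The zero coefficients from \<open>q\<close> on exhibit the point as a member of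
    the whole lattice, where \<open>min\<close> is available; the first \<open>q\<close> are
    reversed to make the coordinates triangular.\<close>
  define V where "V = (\<lambda>x :: nat \<Rightarrow> int. vec d (\<lambda>t. \<Sum>l<r. real_of_int (if l < q then x (q - Suc l) else 0) * bs ! l $ t))"
  have bs: "set bs \<subseteq> carrier_vec d"
    using ind by (auto simp: lin_indpt_list_def)
  have Vcar: "V x \<in> carrier_vec d" for x by (simp add: V_def)
  have VL: "V x \<in> lattice_gen d bs" for x
    unfolding lattice_gen_combination[OF bs] r[symmetric] V_def
    by (rule range_eqI[of _ _ "\<lambda>l. if l < q then x (q - Suc l) else 0"]) simp
  interpret vec_space "TYPE(real)" d .
  have V_hull: "V x \<in> lin_hull d (set bs)" for x
    using VL lin_hull_lattice_gen[OF bs] span_mem[of "lattice_gen d bs"]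
    unfolding lin_hull_def by (force simp: lattice_gen_combination[OF bs])
  have Vw: "V x \<bullet> w = (\<Sum>h<q. real_of_int (x h) * (bs ! (q - Suc h) \<bullet> w))"
    if w: "w \<in> carrier_vec d" for x w
  proof -
    have "V x \<bullet> w = (\<Sum>l<r. real_of_int (if l < q then x (q - Suc l) else 0) * (bs ! l \<bullet> w))"
      by (rule combination_scalar_prod[where d = d]) (use w reciprocal_carrier in \<open>auto simp: V_def\<close>)
    also have "\<dots> = (\<Sum>l<q. real_of_int (x (q - Suc l)) * (bs ! l \<bullet> w))"
      using q by (intro sum.mono_neutral_cong_right) auto
    also have "\<dots> = (\<Sum>h<q. real_of_int (x (q - Suc (q - Suc h))) * (bs ! (q - Suc h) \<bullet> w))"
      by (rule sum.nat_diff_reindex[symmetric])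
    also have "\<dots> = (\<Sum>h<q. real_of_int (x h) * (bs ! (q - Suc h) \<bullet> w))"
      by (intro sum.cong refl) (simp add: Suc_diff_Suc)
    finally show ?thesis .
  qed
  have be: "bs ! (q - Suc h) \<bullet> ?e t = (if t = k + h then 1 else 0)" if "h < q" "t \<le> k + h" "t < r" for h t
  proof -
    have "bs ! (q - Suc h) \<bullet> ?e t = ?e t \<bullet> bs ! (q - Suc h)"
      using that q by (intro comm_scalar_prod[of _ d] reciprocal_carrier gs') auto
    also have "\<dots> = (if (q - Suc h) + t + 1 = r then 1 else 0)"
      using that q by (intro gs_reciprocal_scalar_prod) (auto simp: k_def)
    finally show ?thesis using that q by (auto simp: k_def)
  qed
  define g where "g = (\<lambda>j. 1 / vec_norm (?e (k + j)))"
  define p where "p = (\<lambda>j x. V x \<bullet> ?e (k + j) * g j)"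
  have kj: "k + j < r" if "j < q" for j using that q by (simp add: k_def)
  have gpos: "0 < g j" if "j < q" for j
    using gs_vec_norm_pos[OF reciprocal_lin_indpt] kj[OF that] by (simp add: g_def length_reciprocal)
  have gsq: "(g j)\<^sup>2 = 1 / (?e (k + j) \<bullet> ?e (k + j))" for j
    by (simp add: g_def vec_norm_square power_divide)
  have add: "p i (\<lambda>j. u j - v j) = p i u - p i v" if "i < q" for i u v
    using gs'(3)[OF kj[OF that]]
    by (simp add: p_def Vw left_diff_distrib sum_subtractf)
  have tri: "p i u = g i * real_of_int (u i)" if i: "i < q" and u: "\<forall>j<i. u j = 0" for i u
  proof -
    have "V u \<bullet> ?e (k + i) = (\<Sum>h<q. if h = i then real_of_int (u i) else 0)"
      unfolding Vw[OF gs'(3)[OF kj[OF i]]]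
    proof (intro sum.cong refl)
      fix h assume "h \<in> {..<q}"
      then show "real_of_int (u h) * (bs ! (q - Suc h) \<bullet> ?e (k + i)) = (if h = i then real_of_int (u i) else 0)"
        using be[of h "k + i"] kj[OF i] u by (cases "h < i") auto
    qed
    then show ?thesis using i by (simp add: p_def)
  qed
  have norm: "(\<Sum>j<q. (p j u)\<^sup>2) = V u \<bullet> V u" for u
  proof -
    have low: "V u \<bullet> ?e t = 0" if "t < k" for t
      using that be[of _ t] by (subst Vw) (auto intro!: gs' sum.neutral simp: k_def)
    have "V u \<bullet> V u = (\<Sum>j<r. (V u \<bullet> ?e j)\<^sup>2 / (?e j \<bullet> ?e j))"
      by (rule orthogonal_combination_norm[where d = d, OF _ _ _ _ gs_reciprocal_expansion[OF V_hull]])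
        (simp_all add: gs'(2,3) Vcar)
    also have "\<dots> = (\<Sum>j\<in>{k..<r}. (V u \<bullet> ?e j)\<^sup>2 / (?e j \<bullet> ?e j))"
      using low by (intro sum.mono_neutral_right) (auto simp: k_def)
    also have "\<dots> = (\<Sum>j<q. (V u \<bullet> ?e (k + j))\<^sup>2 / (?e (k + j) \<bullet> ?e (k + j)))"
      by (rule sum.reindex_bij_witness[of _ "\<lambda>j. k + j" "\<lambda>h. h - k"]) (use q in \<open>auto simp: k_def\<close>)
    finally show ?thesis
      by (simp add: p_def power_mult_distrib gsq)
  qed
  show ?thesis
  proof (rule blichfeldt_cube[where p = p and g = g, OF add tri gpos])
    fix u :: "nat \<Rightarrow> int" assume "\<exists>j<q. u j \<noteq> 0"
    then have "\<exists>i. (i < q \<and> u i \<noteq> 0) \<and> (\<forall>j<i. \<not> (j < q \<and> u j \<noteq> 0))"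
      by (subst exists_least_iff[symmetric])
    then obtain i where i: "i < q" "u i \<noteq> 0" "\<forall>j<i. u j = 0"
      using less_trans by blast
    have "p i u \<noteq> 0" using tri[OF i(1,3)] i(2) gpos[OF i(1)] by simp
    then have "V u \<noteq> 0\<^sub>v d"
      using gs'(3)[OF kj[OF i(1)]] by (auto simp: p_def)
    then show "D \<le> (\<Sum>j<q. (p j u)\<^sup>2)"
      unfolding norm by (intro min VL)
  next
    show "2 * (\<Prod>i<q. g i) \<le> s ^ q"
      using s(2) unfolding g_def k_def .
  qed (simp_all add: s(1) D)
qed

end

section \<open>Branch-and-bound at the rootnode\<close>

text \<open>Lagrange's identity: the double sum of squares is twice the difference of the two sides,
  squared.\<close>

lemma Cauchy_Schwarz_vec:
  assumes a: "a \<in> carrier_vec d" and b: "b \<in> carrier_vec d"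
  shows "a \<bullet> b \<le> vec_norm a * vec_norm b"
proof -
  have "0 \<le> (\<Sum>i<d. \<Sum>j<d. (a $ i * b $ j - a $ j * b $ i)\<^sup>2)"
    by (intro sum_nonneg) simp
  also have "\<dots> = (\<Sum>i<d. \<Sum>j<d. (a $ i * a $ i) * (b $ j * b $ j)
      + (b $ i * b $ i) * (a $ j * a $ j) - 2 * ((a $ i * b $ i) * (a $ j * b $ j)))"
    by (intro sum.cong refl) (simp add: power2_eq_square algebra_simps)
  also have "\<dots> = (a \<bullet> a) * (b \<bullet> b) + (b \<bullet> b) * (a \<bullet> a) - 2 * ((a \<bullet> b) * (a \<bullet> b))"
    using a b unfolding scalar_prod_def
    by (simp add: sum_subtractf sum.distrib sum_product sum_distrib_left[symmetric] atLeast0LessThan)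
  finally have "(a \<bullet> b)\<^sup>2 \<le> (a \<bullet> a) * (b \<bullet> b)"
    by (simp add: power2_eq_square)
  also have "\<dots> = (vec_norm a * vec_norm b)\<^sup>2"
    by (simp add: power_mult_distrib vec_norm_square)
  finally show ?thesis
    by (rule power2_le_imp_le) simp
qed

text \<open>The witness is the Gram-Schmidt vector of the reciprocal basis at
  \<open>length bs - q\<close>, with \<open>q = Suc i\<close>. The product \<open>W\<close> of the
  last \<open>q\<close> norms is the determinant of the projected reciprocal lattice, and
  \<open>1 / W\<close> that of its dual. With cube sides \<open>root q (2 * W)\<close> and
  \<open>root q (2 / W)\<close> the two bounds multiply to one in which \<open>W\<close> has
  cancelled.\<close>

lemma RKZ_short_dual_vector:
  assumes RKZ: "RKZ_reduced_basis d bs L" and i: "i < length bs"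
    and min: "\<And>v. v \<in> L \<Longrightarrow> v \<noteq> 0\<^sub>v d \<Longrightarrow> \<Lambda> \<le> vec_norm v" and \<Lambda>: "0 \<le> \<Lambda>"
  shows "\<exists>z\<in>carrier_vec d. bs ! i \<bullet> z = 1 \<and> (\<forall>j<i. bs ! j \<bullet> z = 0) \<and>
    \<Lambda> * vec_norm z \<le> real (Suc i) / 3 * root (Suc i) 4"
proof -
  obtain bs' where ind: "lin_indpt_list d bs" and L: "lattice_gen d bs = L"
    and rec: "reciprocal_basis d bs bs'" and KZ: "KZ_reduced_basis d bs' (reciprocal_lattice d L)"
    using RKZ by (auto simp: RKZ_reduced_basis_def lattice_basis_def)
  let ?r = "length bs" and ?q = "Suc i"
  let ?e = "gs_vec d bs'"
  note len = length_reciprocal[OF ind rec refl]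
  note ind' = reciprocal_lin_indpt[OF ind rec refl]
  note gs = gram_schmidt_basis[OF ind', unfolded len]
  define W where "W = (\<Prod>j<?q. vec_norm (?e (?r - ?q + j)))"
  have W: "0 < W"
    unfolding W_def using i by (intro prod_pos ballI gs_vec_norm_pos[OF ind']) (simp add: len)
  have "(\<Prod>j<?q. vec_norm (?e (?r - 1 - j))) = (\<Prod>j<?q. vec_norm (?e (?r - ?q + (?q - Suc j))))"
    using i by (intro prod.cong refl arg_cong[of _ _ "\<lambda>t. vec_norm (?e t)"]) auto
  also have "\<dots> = W"
    unfolding W_def by (rule prod.nat_diff_reindex)
  finally have W': "(\<Prod>j<?q. vec_norm (?e (?r - 1 - j))) = W" .
  let ?z = "?e (?r - ?q)"
  have z: "(vec_norm ?z)\<^sup>2 \<le> real ?q * (root ?q (2 * W))\<^sup>2 / 3"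
  proof (rule KZ_first_vector_bound[OF KZ, unfolded len])
    show "2 * (\<Prod>j<?q. vec_norm (?e (?r - 1 - j))) \<le> root ?q (2 * W) ^ ?q"
      unfolding W' using W by (subst real_root_pow_pos) simp_all
  qed (use i W in auto)
  have l: "\<Lambda>\<^sup>2 \<le> real ?q * (root ?q (2 / W))\<^sup>2 / 3"
  proof (rule sublattice_shortest_vector_bound[OF ind rec refl])
    show "\<Lambda>\<^sup>2 \<le> v \<bullet> v" if "v \<in> lattice_gen d bs" "v \<noteq> 0\<^sub>v d" for v
      using min[of v] that L \<Lambda> unfolding vec_norm_square[symmetric] by (intro power_mono) auto
    show "2 * (\<Prod>j<?q. 1 / vec_norm (?e (?r - ?q + j))) \<le> root ?q (2 / W) ^ ?q"
      using W by (subst real_root_pow_pos) (simp_all only: prod_dividef W_def[symmetric], simp_all)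
  qed (use i W in auto)
  have "(\<Lambda> * vec_norm ?z)\<^sup>2 \<le> (real ?q * (root ?q (2 / W))\<^sup>2 / 3) * (real ?q * (root ?q (2 * W))\<^sup>2 / 3)"
    unfolding power_mult_distrib by (intro mult_mono z l) auto
  also have "\<dots> = (real ?q / 3 * (root ?q (2 / W) * root ?q (2 * W)))\<^sup>2"
    by (simp add: power2_eq_square)
  also have "root ?q (2 / W) * root ?q (2 * W) = root ?q 4"
    unfolding real_root_mult[symmetric] using W by simp
  finally have le: "\<Lambda> * vec_norm ?z \<le> real ?q / 3 * root ?q 4"
    by (rule power2_le_imp_le) simp
  have zc: "?z \<in> carrier_vec d"
    using i gs by simp
  have "bs ! j \<bullet> ?z = (if j = i then 1 else 0)" if "j \<le> i" for j
  proof -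
    have "bs ! j \<bullet> ?z = ?z \<bullet> bs ! j"
      using that i reciprocal_carrier(1)[OF ind rec refl] by (intro comm_scalar_prod[OF _ zc]) auto
    also have "\<dots> = (if j + (?r - ?q) + 1 = ?r then 1 else 0)"
      using that i by (intro gs_reciprocal_scalar_prod[OF ind rec refl]) auto
    finally show ?thesis using that i by auto
  qed
  then show ?thesis
    using zc le by (intro bexI[of _ ?z]) auto
qed

text \<open>By induction, two nodes of equal depth have the same parent. Both last labels lie
  between values of one coordinate on the parent's subproblem, where that coordinate varies by less
  than 1, so the two integers agree.\<close>

lemma solves_at_rootnodeI:
  assumes P: "\<And>i u v. \<lbrakk>i < r; u \<in> P; v \<in> P; \<forall>j. i < j \<and> j < r \<longrightarrow> u $ j = v $ j\<rbrakk> \<Longrightarrow> v $ i - u $ i < 1"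
  shows "solves_at_rootnode r P"
proof -
  have uniq: "\<gamma>s = \<gamma>s'"
    if "\<gamma>s \<in> bb_nodes r P" "\<gamma>s' \<in> bb_nodes r P" "length \<gamma>s = length \<gamma>s'" for \<gamma>s \<gamma>s'
    using that
  proof (induction arbitrary: \<gamma>s' rule: bb_nodes.induct)
    case root
    then show ?case by simp
  next
    case (branch \<gamma>s u \<gamma> v)
    from branch.prems obtain \<delta>s u' \<delta> v' where \<delta>: "\<gamma>s' = \<delta>s @ [\<delta>]" "\<delta>s \<in> bb_nodes r P"
      and u': "u' \<in> bb_subproblem r P \<delta>s" "u' $ (r - 1 - length \<delta>s) \<le> real_of_int \<delta>"
      and v': "v' \<in> bb_subproblem r P \<delta>s" "real_of_int \<delta> \<le> v' $ (r - 1 - length \<delta>s)"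
      by (cases rule: bb_nodes.cases) auto
    have eq: "\<delta>s = \<gamma>s"
      using branch.IH[OF \<delta>(2)] branch.prems(2) \<delta>(1) by simp
    let ?i = "r - 1 - length \<gamma>s"
    have gap: "y $ ?i - x $ ?i < 1" if "x \<in> bb_subproblem r P \<gamma>s" "y \<in> bb_subproblem r P \<gamma>s" for x y
    proof (rule P)
      show "\<forall>j. ?i < j \<and> j < r \<longrightarrow> x $ j = y $ j"
      proof (intro allI impI)
        fix j assume j: "?i < j \<and> j < r"
        \<comment> \<open>Variables are fixed from the last one down: coordinate \<open>j\<close>
          was fixed by entry \<open>r - 1 - j\<close> of the node.\<close>
        then have "r - 1 - j < length \<gamma>s" "r - 1 - (r - 1 - j) = j" by auto
        then show "x $ j = y $ j"
          using that unfolding bb_subproblem_def by (metis (mono_tags, lifting) mem_Collect_eq)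
      qed
    qed (use that branch.hyps in \<open>auto simp: bb_subproblem_def\<close>)
    have "\<not> \<gamma> < \<delta>"
      using gap[OF branch.hyps(3) v'(1)[unfolded eq]] branch.hyps(4) v'(2) unfolding eq by linarith
    moreover have "\<not> \<delta> < \<gamma>"
      using gap[OF u'(1)[unfolded eq] branch.hyps(5)] branch.hyps(6) u'(2) unfolding eq by linarith
    ultimately show ?case
      using \<delta>(1) eq by simp
  qed
  have "finite (bb_level r P i) \<and> card (bb_level r P i) \<le> 1" for i
  proof (cases "bb_level r P i = {}")
    case False
    then obtain x where "x \<in> bb_level r P i" by auto
    then have "bb_level r P i \<subseteq> {x}"
      using uniq by (auto simp: bb_level_def)
    then show ?thesis
      using card_mono[of "{x}"] finite_subset by fastforce
  qed simp
  then show ?thesis by (simp add: solves_at_rootnode_def)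
qed

text \<open>Pair the difference of the images of two feasible points with the dual vector
  \<open>z\<close>: the columns below \<open>i\<close> are orthogonal to \<open>z\<close>, those
  above have coefficient 0, and \<open>v $ i - u $ i\<close> remains. By Cauchy-Schwarz it is at
  most \<open>vec_norm (w - l) * vec_norm z\<close>, which is below 1 because \<open>C\<close>
  exceeds the transference constant and \<open>C * vec_norm (w - l)\<close> bounds the nonzero
  lattice vectors from below.\<close>

theorem RKZ_solves_at_rootnode:
  fixes B :: "real mat"
  assumes B: "B \<in> carrier_mat d r" and l: "l \<in> carrier_vec d" and w: "w \<in> carrier_vec d"
    and RKZ: "RKZ_reduced_basis d (cols B) L"
    and C: "\<And>i. i < r \<Longrightarrow> real (Suc i) / 3 * root (Suc i) 4 < C"
    and min: "\<And>v. v \<in> L \<Longrightarrow> v \<noteq> 0\<^sub>v d \<Longrightarrow> C * vec_norm (w - l) \<le> vec_norm v"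
  shows "solves_at_rootnode r {y \<in> carrier_vec r. l \<le> B *\<^sub>v y \<and> B *\<^sub>v y \<le> w}"
proof (rule solves_at_rootnodeI)
  fix i u v
  assume i: "i < r" and u: "u \<in> {y \<in> carrier_vec r. l \<le> B *\<^sub>v y \<and> B *\<^sub>v y \<le> w}"
    and v: "v \<in> {y \<in> carrier_vec r. l \<le> B *\<^sub>v y \<and> B *\<^sub>v y \<le> w}"
    and uv: "\<forall>j. i < j \<and> j < r \<longrightarrow> u $ j = v $ j"
  have "0 \<le> real (Suc i) / 3 * root (Suc i) 4" by simp
  then have C0: "0 < C" using C[OF i] by linarith
  let ?N = "vec_norm (w - l)"
  have len: "length (cols B) = r" using B by simp
  obtain z where z: "z \<in> carrier_vec d" "cols B ! i \<bullet> z = 1" "\<forall>j<i. cols B ! j \<bullet> z = 0"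
    and "C * ?N * vec_norm z \<le> real (Suc i) / 3 * root (Suc i) 4"
    using RKZ_short_dual_vector[OF RKZ, of i "C * ?N"] i len min C0 by auto
  then have "C * (?N * vec_norm z) < C * 1"
    using C[OF i] by (simp add: mult.assoc)
  then have small: "?N * vec_norm z < 1"
    using C0 by (simp only: mult_less_cancel_left_pos)
  define x where "x = B *\<^sub>v v - B *\<^sub>v u"
  have x: "x \<in> carrier_vec d" using B by (intro carrier_vecI) (simp add: x_def)
  have "x \<bullet> z = (\<Sum>j<r. (v $ j - u $ j) * (cols B ! j \<bullet> z))"
  proof (rule combination_scalar_prod[where d = d])
    fix t assume t: "t < d"
    have Bt: "(B *\<^sub>v y) $ t = (\<Sum>j<r. y $ j * cols B ! j $ t)" if "y \<in> carrier_vec r" for y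
      using that t B by (simp add: scalar_prod_def atLeast0LessThan mult.commute)
    show "x $ t = (\<Sum>j<r. (v $ j - u $ j) * cols B ! j $ t)"
      using t B u v Bt[of u] Bt[of v] by (simp add: x_def left_diff_distrib sum_subtractf)
  qed (use z B in auto)
  also have "\<dots> = (\<Sum>j<r. if j = i then v $ i - u $ i else 0)"
  proof (intro sum.cong refl)
    fix j assume "j \<in> {..<r}"
    then show "(v $ j - u $ j) * (cols B ! j \<bullet> z) = (if j = i then v $ i - u $ i else 0)"
      using z uv by (cases j i rule: linorder_cases) auto
  qed
  also have "\<dots> = v $ i - u $ i" using i by simp
  finally have "v $ i - u $ i = x \<bullet> z" by simp
  also have "\<dots> \<le> vec_norm x * vec_norm z"
    by (rule Cauchy_Schwarz_vec[OF x z(1)])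
  also have "\<dots> \<le> ?N * vec_norm z"
  proof (rule mult_right_mono)
    \<comment> \<open>Entry by entry, both images lie between \<open>l\<close> and
      \<open>w\<close>.\<close>
    have "x \<bullet> x \<le> (w - l) \<bullet> (w - l)"
      unfolding scalar_prod_def
    proof (use x w l in \<open>simp, intro sum_mono\<close>)
      fix t assume "t \<in> {0..<d}"
      then have t: "t < d" by simp
      have "l $ t \<le> (B *\<^sub>v y) $ t" "(B *\<^sub>v y) $ t \<le> w $ t"
        if "y \<in> {y \<in> carrier_vec r. l \<le> B *\<^sub>v y \<and> B *\<^sub>v y \<le> w}" for y
        using that t w B by (auto simp: less_eq_vec_def)
      from this[OF u] this[OF v] have "\<bar>(B *\<^sub>v v) $ t - (B *\<^sub>v u) $ t\<bar> \<le> \<bar>w $ t - l $ t\<bar>"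
        by linarith
      then have "\<bar>x $ t\<bar> \<le> \<bar>w $ t - l $ t\<bar>"
        using t B by (simp add: x_def)
      then show "x $ t * x $ t \<le> (w $ t - l $ t) * (w $ t - l $ t)"
        by (simp only: abs_le_square_iff power2_eq_square)
    qed
    then show "vec_norm x \<le> ?N"
      unfolding vec_norm_def by simp
  qed simp
  finally show "v $ i - u $ i < 1"
    using small by linarith
qed

section \<open>Counting matrices\<close>

lemma card_G_mats: "finite (G_mats m n M)" "card (G_mats m n M) = M ^ (m * n)"
proof -
  let ?F = "PiE ({..<m} \<times> {..<n}) (\<lambda>_. {1..int M})"
  have "bij_betw (\<lambda>A. restrict (\<lambda>ij. A $$ ij) ({..<m} \<times> {..<n})) (G_mats m n M) ?F"
  proof (rule bij_betw_byWitness[where f' = "\<lambda>F. mat m n F"])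
    show "\<forall>A\<in>G_mats m n M. mat m n (restrict (\<lambda>ij. A $$ ij) ({..<m} \<times> {..<n})) = A"
      by (auto simp: G_mats_def intro!: eq_matI)
    show "\<forall>F\<in>?F. restrict (\<lambda>ij. mat m n F $$ ij) ({..<m} \<times> {..<n}) = F"
      by (auto simp: fun_eq_iff PiE_def extensional_def restrict_def)
    show "(\<lambda>A. restrict (\<lambda>ij. A $$ ij) ({..<m} \<times> {..<n})) ` G_mats m n M \<subseteq> ?F"
      by (auto simp: G_mats_def image_subset_iff restrict_PiE_iff)
    show "mat m n ` ?F \<subseteq> G_mats m n M"
      by (fastforce simp: G_mats_def PiE_def Pi_def)
  qed
  moreover have "finite ?F" by (intro finite_PiE) auto
  moreover have "card ?F = M ^ (m * n)" by (simp add: card_PiE)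
  ultimately show "finite (G_mats m n M)" "card (G_mats m n M) = M ^ (m * n)"
    by (simp_all add: bij_betw_finite bij_betw_same_card)
qed

text \<open>Forgetting a column \<open>j0\<close> with \<open>z $ j0 \<noteq> 0\<close> is injective
  on the solutions, as each row of the equation returns the missing entry. Multiplying by
  \<open>M ^ m\<close> keeps the count in the natural numbers.\<close>

lemma card_G_mats_solutions:
  assumes z: "z \<in> carrier_vec n" "z \<noteq> 0\<^sub>v n"
  shows "card {A \<in> G_mats m n M. A *\<^sub>v z = y} * M ^ m \<le> M ^ (m * n)"
proof -
  obtain j0 where j0: "j0 < n" "z $ j0 \<noteq> 0"
    using z by (metis carrier_vecD eq_vecI index_zero_vec)
  let ?J = "{..<m} \<times> ({..<n} - {j0})"
  let ?F = "PiE ?J (\<lambda>_. {1..int M})"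
  let ?S = "{A \<in> G_mats m n M. A *\<^sub>v z = y}"
  have "inj_on (\<lambda>A. restrict (\<lambda>ij. A $$ ij) ?J) ?S"
  proof (rule inj_onI)
    fix A B assume AB: "A \<in> ?S" "B \<in> ?S"
      and eq: "restrict (\<lambda>ij. A $$ ij) ?J = restrict (\<lambda>ij. B $$ ij) ?J"
    have car: "A \<in> carrier_mat m n" "B \<in> carrier_mat m n"
      using AB by (auto simp: G_mats_def)
    have off: "A $$ (i, j) = B $$ (i, j)" if "i < m" "j < n" "j \<noteq> j0" for i j
      using fun_cong[OF eq, of "(i, j)"] that by simp
    have split: "(C *\<^sub>v z) $ i = C $$ (i, j0) * z $ j0 + (\<Sum>j\<in>{0..<n} - {j0}. C $$ (i, j) * z $ j)"
      if "C \<in> carrier_mat m n" "i < m" for C :: "int mat" and i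
      using that z j0 by (simp add: scalar_prod_def sum.remove[of "{0..<n}" j0])
    show "A = B"
    proof (rule eq_matI)
      fix i j assume "i < dim_row B" "j < dim_col B"
      then have ij: "i < m" "j < n" using car by auto
      have "(A *\<^sub>v z) $ i = (B *\<^sub>v z) $ i" using AB by simp
      moreover have "(\<Sum>j\<in>{0..<n} - {j0}. A $$ (i, j) * z $ j) = (\<Sum>j\<in>{0..<n} - {j0}. B $$ (i, j) * z $ j)"
        using off ij by (intro sum.cong refl) auto
      ultimately have "A $$ (i, j0) = B $$ (i, j0)"
        using split[OF car(1) ij(1)] split[OF car(2) ij(1)] j0(2) by simp
      then show "A $$ (i, j) = B $$ (i, j)"
        using off ij by (cases "j = j0") auto
    qed (use car in auto)
  qed
  moreover have "(\<lambda>A. restrict (\<lambda>ij. A $$ ij) ?J) ` ?S \<subseteq> ?F"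
    by (auto simp: G_mats_def image_subset_iff restrict_PiE_iff)
  moreover have "finite ?F" by (intro finite_PiE) auto
  ultimately have "card ?S \<le> card ?F"
    by (rule card_inj_on_le)
  also have "\<dots> = M ^ (m * (n - 1))"
    using j0 by (simp add: card_PiE card_cartesian_product)
  finally have "card ?S * M ^ m \<le> M ^ (m * (n - 1)) * M ^ m"
    by (intro mult_right_mono) auto
  also have "\<dots> = M ^ (m * n)"
    using j0 by (cases n) (simp_all add: power_add)
  finally show ?thesis .
qed

text \<open>A union bound over the pairs \<open>(y, z)\<close> with \<open>z\<close>
  nonzero.\<close>

lemma card_bad_mats:
  assumes Y: "finite Y" and Z: "finite Z" "Z \<subseteq> carrier_vec n"
    and S: "\<And>A. A \<in> S \<Longrightarrow> A \<in> G_mats m n M \<and> (\<exists>z\<in>Z. z \<noteq> 0\<^sub>v n \<and> A *\<^sub>v z \<in> Y)"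
  shows "card S * M ^ m \<le> card Y * card Z * M ^ (m * n)"
proof -
  let ?Z = "Z - {0\<^sub>v n}"
  let ?T = "\<lambda>(y, z). {A \<in> G_mats m n M. A *\<^sub>v z = y}"
  have fin: "finite (Y \<times> ?Z)" using Y Z by simp
  have "card S \<le> card (\<Union>yz\<in>Y \<times> ?Z. ?T yz)"
    using fin card_G_mats(1) by (intro card_mono finite_UN_I) (use S in \<open>auto, blast\<close>)
  also have "\<dots> \<le> (\<Sum>yz\<in>Y \<times> ?Z. card (?T yz))"
    by (rule card_UN_le[OF fin])
  finally have "card S * M ^ m \<le> (\<Sum>yz\<in>Y \<times> ?Z. card (?T yz)) * M ^ m"
    by (rule mult_right_mono) simp
  also have "\<dots> = (\<Sum>yz\<in>Y \<times> ?Z. card (?T yz) * M ^ m)"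
    by (rule sum_distrib_right)
  also have "\<dots> \<le> (\<Sum>yz\<in>Y \<times> ?Z. M ^ (m * n))"
    using Z by (intro sum_mono) (auto intro!: card_G_mats_solutions)
  also have "\<dots> = card Y * card ?Z * M ^ (m * n)"
    by (simp add: card_cartesian_product)
  also have "\<dots> \<le> card Y * card Z * M ^ (m * n)"
    using Z by (intro mult_right_mono mult_left_mono card_mono) auto
  finally show ?thesis .
qed

text \<open>A cube contains the integer points of the Euclidean ball of radius \<open>k\<close> and
  is simple to count.\<close>

definition int_box :: "nat \<Rightarrow> real \<Rightarrow> int vec set" where
  "int_box n k = {v \<in> carrier_vec n. \<forall>i<n. \<bar>real_of_int (v $ i)\<bar> \<le> k}"

lemma card_int_box:
  assumes k: "0 \<le> k"
  shows "finite (int_box n k)" "real (card (int_box n k)) \<le> (2 * k + 1) ^ n"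
proof -
  let ?F = "PiE {..<n} (\<lambda>_. {-\<lfloor>k\<rfloor>..\<lfloor>k\<rfloor>})"
  have fl: "real_of_int \<lfloor>k\<rfloor> \<le> k" "0 \<le> \<lfloor>k\<rfloor>" using k by auto
  have inj: "inj_on (\<lambda>v. restrict (\<lambda>i. v $ i) {..<n}) (int_box n k)"
  proof (rule inj_onI)
    fix u v :: "int vec"
    assume uv: "u \<in> int_box n k" "v \<in> int_box n k"
      and eq: "restrict (\<lambda>i. u $ i) {..<n} = restrict (\<lambda>i. v $ i) {..<n}"
    have "u $ i = v $ i" if "i < n" for i
      using fun_cong[OF eq, of i] that by simp
    then show "u = v"
      using uv by (intro eq_vecI) (auto simp: int_box_def)
  qed
  have "(\<lambda>v. restrict (\<lambda>i. v $ i) {..<n}) ` int_box n k \<subseteq> ?F"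
  proof clarsimp
    fix v i assume "v \<in> int_box n k" "i < n"
    then have "\<bar>real_of_int (v $ i)\<bar> \<le> k" by (simp add: int_box_def)
    then show "- \<lfloor>k\<rfloor> \<le> v $ i \<and> v $ i \<le> \<lfloor>k\<rfloor>" by linarith
  qed
  moreover have "finite ?F" by (intro finite_PiE) auto
  ultimately show "finite (int_box n k)"
    using inj finite_imageD finite_subset by blast
  have "card (int_box n k) \<le> card ?F"
    by (rule card_inj_on_le) fact+
  also have "card ?F = nat (2 * \<lfloor>k\<rfloor> + 1) ^ n"
    by (simp add: card_PiE algebra_simps)
  finally have "real (card (int_box n k)) \<le> real (nat (2 * \<lfloor>k\<rfloor> + 1)) ^ n"
    by (metis of_nat_le_iff of_nat_power)
  also have "\<dots> \<le> (2 * k + 1) ^ n"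
    using fl by (intro power_mono) auto
  finally show "real (card (int_box n k)) \<le> (2 * k + 1) ^ n" .
qed

lemma abs_index_le_vec_norm:
  assumes "i < dim_vec v"
  shows "\<bar>v $ i\<bar> \<le> vec_norm v"
proof (rule power2_le_imp_le)
  have "v $ i * v $ i \<le> v \<bullet> v"
    unfolding scalar_prod_def using assms by (intro member_le_sum[of _ _ "\<lambda>i. v $ i * v $ i"]) auto
  then show "\<bar>v $ i\<bar>\<^sup>2 \<le> (vec_norm v)\<^sup>2"
    by (simp add: vec_norm_square) (simp add: power2_eq_square)
qed simp

lemma int_box_vec_norm:
  assumes "v \<in> carrier_vec n" "vec_norm (real_vec v) \<le> k"
  shows "v \<in> int_box n k"
proof -
  have "\<bar>real_of_int (v $ i)\<bar> \<le> k" if "i < n" for i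
    using assms that abs_index_le_vec_norm[of i "real_vec v"] by simp
  then show ?thesis using assms(1) by (simp add: int_box_def)
qed

text \<open>Distinct integers differ by at least 1. The resulting lower bound on the norm is what
  later absorbs the rounding term in \<open>2 * k + 1\<close>.\<close>

lemma nonempty_box_norm:
  assumes "v \<in> carrier_vec n" "u \<in> carrier_vec n" "\<And>i. i < n \<Longrightarrow> u $ i < v $ i"
  shows "real n \<le> (vec_norm (real_vec (v - u)))\<^sup>2"
proof -
  have "real n = (\<Sum>i = 0..<n. 1)" by simp
  also have "\<dots> \<le> (\<Sum>i = 0..<n. (real_of_int (v $ i) - real_of_int (u $ i)) * (real_of_int (v $ i) - real_of_int (u $ i)))"
  proof (intro sum_mono)
    fix i assume "i \<in> {0..<n}"
    then have "1 \<le> real_of_int (v $ i) - real_of_int (u $ i)"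
      using assms(3)[of i] by auto
    then show "1 \<le> (real_of_int (v $ i) - real_of_int (u $ i)) * (real_of_int (v $ i) - real_of_int (u $ i))"
      by (metis mult_mono' mult_1 zero_le_one)
  qed
  also have "\<dots> = (vec_norm (real_vec (v - u)))\<^sup>2"
    unfolding vec_norm_square scalar_prod_def using assms by (intro sum.cong) auto
  finally show ?thesis .
qed

text \<open>The constant is below 1/2, which leaves room for the rounding when integer points are counted.\<close>

lemma transference_constant_le:
  assumes "i < n" "5 \<le> n"
  shows "real (Suc i) / 3 * root (Suc i) 4 < 44 / 100 * real n"
proof -
  have rt: "root (Suc i) 4 < c" if "0 \<le> c" "4 < c ^ Suc i" for c
    using real_root_less_mono[OF _ that(2), of "Suc i"] that(1)
    by (simp only: real_root_power_cancel)
  \<comment> \<open>For \<open>i < 4\<close> crude bounds on the root suffice, since the right side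
    is at least 11/5. From \<open>i = 4\<close> on, 1.32 is enough: its fifth power exceeds 4, and a
    third of it is 0.44.\<close>
  consider "i = 0" | "i = 1" | "i = 2" | "i = 3" | "4 \<le> i" by linarith
  then show ?thesis
  proof cases
    case 4
    have "root (Suc i) 4 < 3 / 2" using 4 by (intro rt) (simp_all add: eval_nat_numeral)
    then show ?thesis using 4 assms by simp
  next
    case 3
    have "root (Suc i) 4 < 8 / 5" using 3 by (intro rt) (simp_all add: eval_nat_numeral)
    then show ?thesis using 3 assms by simp
  next
    case 2
    have "root (Suc i) 4 < 21 / 10" using 2 by (intro rt) (simp_all add: eval_nat_numeral)
    then show ?thesis using 2 assms by simp
  next
    case 1
    then show ?thesis using assms by simp
  next
    case 5
    have "4 < (132 / 100 :: real) ^ 5" by (simp add: eval_nat_numeral)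
    also have "\<dots> \<le> (132 / 100) ^ Suc i" using 5 by (intro power_increasing) auto
    finally have "root (Suc i) 4 < 132 / 100" by (intro rt) auto
    then have "real (Suc i) / 3 * root (Suc i) 4 < real (Suc i) / 3 * (132 / 100)"
      by (intro mult_strict_left_mono) auto
    also have "\<dots> \<le> 44 / 100 * real n" using assms by simp
    finally show ?thesis .
  qed
qed

text \<open>Raising to the power \<open>m\<close> clears the denominator of the exponent.\<close>

lemma power_less_of_powr:
  assumes "0 < X" "0 < m" "X powr (real a / real m) < real M"
  shows "X ^ a < real M ^ m"
proof -
  have "X ^ a = (X powr (real a / real m)) powr real m"
    using assms by (simp add: powr_powr powr_realpow)
  also have "\<dots> = (X powr (real a / real m)) ^ m"
    using assms by (simp add: powr_realpow)
  also have "\<dots> < real M ^ m"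
    using assms by (intro power_strict_mono) auto
  finally show ?thesis .
qed

section \<open>From failure at the rootnode to a short integral vector\<close>

lemma stack_id_lattice:
  assumes A: "A \<in> carrier_mat m n" and v: "v \<in> lattice_gen (m + n) (cols (real_mat (stack_id A)))"
  obtains z where "z \<in> carrier_vec n" "v = real_vec ((A *\<^sub>v z) @\<^sub>v z)"
proof -
  have S: "stack_id A \<in> carrier_mat (m + n) n"
    using A by (auto simp: stack_id_def)
  have "set (cols (real_mat (stack_id A))) \<subseteq> carrier_vec (m + n)"
    using S cols_dim[of "real_mat (stack_id A)"] by auto
  then obtain c :: "nat \<Rightarrow> int" where
    v: "v = vec (m + n) (\<lambda>t. \<Sum>l<length (cols (real_mat (stack_id A))).
      real_of_int (c l) * cols (real_mat (stack_id A)) ! l $ t)"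
    using v lattice_gen_combination by auto
  have z: "vec n c \<in> carrier_vec n" by simp
  have "(A *\<^sub>v vec n c) @\<^sub>v vec n c = stack_id A *\<^sub>v vec n c"
    using A mat_mult_append[OF A one_carrier_mat z] by (simp add: stack_id_def)
  moreover have "v = real_vec (stack_id A *\<^sub>v vec n c)"
    unfolding v using S by (intro eq_vecI) (auto simp: scalar_prod_def atLeast0LessThan mult.commute intro!: sum.cong)
  ultimately show thesis using that[OF z] by simp
qed

lemma vec_norm_append:
  assumes "u \<in> carrier_vec m" "v \<in> carrier_vec n"
  shows "(vec_norm (real_vec (u @\<^sub>v v)))\<^sup>2 = (vec_norm (real_vec u))\<^sup>2 + (vec_norm (real_vec v))\<^sup>2"
proof -
  have "real_vec (u @\<^sub>v v) = real_vec u @\<^sub>v real_vec v"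
    using assms by (intro eq_vecI) auto
  then show ?thesis
    using assms by (simp add: vec_norm_square scalar_prod_append[of _ m _ n])
qed

lemma real_vec_minus:
  assumes "u \<in> carrier_vec n" "v \<in> carrier_vec n"
  shows "real_vec u - real_vec v = real_vec (u - v)"
  using assms by (intro eq_vecI) auto

text \<open>The contrapositive of \<open>RKZ_solves_at_rootnode\<close> with constant
  \<open>0.44 * n\<close>: failure yields a nonzero lattice vector, \<open>A *\<^sub>v z\<close>
  stacked on \<open>z\<close>, shorter than \<open>k\<close>. Neither half is longer than the whole,
  and \<open>z = 0\<close> would make the whole vanish.\<close>

lemma rangespace_bad_vector:
  assumes A: "A \<in> carrier_mat m n" and n: "5 \<le> n"
    and l: "l1 \<in> carrier_vec m" "l2 \<in> carrier_vec n" and w: "w1 \<in> carrier_vec m" "w2 \<in> carrier_vec n"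
    and bad: "\<not> rangespace_solved_at_rootnode A l1 w1 l2 w2"
    and k: "k = 44 / 100 * real n * vec_norm (real_vec ((w1 @\<^sub>v w2) - (l1 @\<^sub>v l2)))"
  shows "\<exists>z\<in>int_box n k. z \<noteq> 0\<^sub>v n \<and> A *\<^sub>v z \<in> int_box m k"
proof -
  obtain U where U: "rangespace_transform A U"
    and ns: "\<not> solves_at_rootnode n (rangespace_polyhedron A l1 w1 l2 w2 U)"
    using bad A by (auto simp: rangespace_solved_at_rootnode_def)
  let ?B = "real_mat (stack_id A * U)"
  let ?L = "lattice_gen (m + n) (cols (real_mat (stack_id A)))"
  have RKZ: "RKZ_reduced_basis (m + n) (cols ?B) ?L" and Uc: "U \<in> carrier_mat n n"
    using U A by (auto simp: rangespace_transform_def unimodular_def)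
  have "stack_id A \<in> carrier_mat (m + n) n"
    using A by (auto simp: stack_id_def)
  then have B: "?B \<in> carrier_mat (m + n) n"
    using mult_carrier_mat[OF _ Uc] by simp
  have diff: "real_vec (w1 @\<^sub>v w2) - real_vec (l1 @\<^sub>v l2) = real_vec ((w1 @\<^sub>v w2) - (l1 @\<^sub>v l2))"
    using l w by (intro real_vec_minus[where n = "m + n"]) auto
  have "\<exists>v\<in>?L. v \<noteq> 0\<^sub>v (m + n) \<and> vec_norm v < k"
  proof (rule ccontr)
    assume no: "\<not> ?thesis"
    have "solves_at_rootnode n {y \<in> carrier_vec n. real_vec (l1 @\<^sub>v l2) \<le> ?B *\<^sub>v y \<and> ?B *\<^sub>v y \<le> real_vec (w1 @\<^sub>v w2)}"
    proof (rule RKZ_solves_at_rootnode[OF B _ _ RKZ])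
      show "44 / 100 * real n * vec_norm (real_vec (w1 @\<^sub>v w2) - real_vec (l1 @\<^sub>v l2)) \<le> vec_norm v"
        if "v \<in> ?L" "v \<noteq> 0\<^sub>v (m + n)" for v
        using no that unfolding diff k by force
    qed (use l w n transference_constant_le in auto)
    then show False using ns A by (simp add: rangespace_polyhedron_def)
  qed
  then obtain v where v: "v \<in> ?L" "v \<noteq> 0\<^sub>v (m + n)" "vec_norm v < k" by auto
  obtain z where z: "z \<in> carrier_vec n" and vz: "v = real_vec ((A *\<^sub>v z) @\<^sub>v z)"
    using stack_id_lattice[OF A v(1)] .
  have Az: "A *\<^sub>v z \<in> carrier_vec m" using A z by auto
  have sq: "(vec_norm v)\<^sup>2 = (vec_norm (real_vec (A *\<^sub>v z)))\<^sup>2 + (vec_norm (real_vec z))\<^sup>2"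
    unfolding vz by (rule vec_norm_append[OF Az z])
  have "vec_norm (real_vec (A *\<^sub>v z)) \<le> vec_norm v" "vec_norm (real_vec z) \<le> vec_norm v"
    by (rule power2_le_imp_le; simp add: sq)+
  moreover have "z \<noteq> 0\<^sub>v n"
  proof
    assume "z = 0\<^sub>v n"
    then have "v = 0\<^sub>v (m + n)"
      unfolding vz using A by (intro eq_vecI) auto
    then show False using v(2) by simp
  qed
  ultimately show ?thesis
    using v(3) z Az by (intro bexI[of _ z] conjI int_box_vec_norm) auto
qed

text \<open>The same contrapositive for the kernel lattice, whose vectors satisfy
  \<open>A *\<^sub>v z = 0\<close>. The shift \<open>x0\<close> cancels in the difference of the two
  bounds.\<close>

lemma nullspace_bad_vector:
  assumes A: "A \<in> carrier_mat m n"
    and l: "l2 \<in> carrier_vec n" and w: "w2 \<in> carrier_vec n"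
    and bad: "\<not> nullspace_solved_at_rootnode A l1 l2 w2"
    and k: "k = 3 / 2 * real (n - m) * vec_norm (real_vec (w2 - l2))"
  shows "\<exists>z\<in>int_box n k. z \<noteq> 0\<^sub>v n \<and> A *\<^sub>v z \<in> {0\<^sub>v m}"
proof -
  obtain B x0 where B: "nullspace_basis A B" and x0: "x0 \<in> carrier_vec n"
    and ns: "\<not> solves_at_rootnode (n - m) (nullspace_polyhedron A l2 w2 B x0)"
    using bad A by (auto simp: nullspace_solved_at_rootnode_def)
  let ?L = "real_vec ` mat_kernel A"
  have RKZ: "RKZ_reduced_basis n (cols (real_mat B)) ?L" and Bc: "real_mat B \<in> carrier_mat n (n - m)"
    using B A by (auto simp: nullspace_basis_def)
  have diff: "real_vec (w2 - x0) - real_vec (l2 - x0) = real_vec (w2 - l2)"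
    using l w x0 by (intro eq_vecI) auto
  have "\<exists>v\<in>?L. v \<noteq> 0\<^sub>v n \<and> vec_norm v < k"
  proof (rule ccontr)
    assume no: "\<not> ?thesis"
    have "solves_at_rootnode (n - m) {y \<in> carrier_vec (n - m).
        real_vec (l2 - x0) \<le> real_mat B *\<^sub>v y \<and> real_mat B *\<^sub>v y \<le> real_vec (w2 - x0)}"
    proof (rule RKZ_solves_at_rootnode[OF Bc _ _ RKZ])
      show "3 / 2 * real (n - m) * vec_norm (real_vec (w2 - x0) - real_vec (l2 - x0)) \<le> vec_norm v"
        if "v \<in> ?L" "v \<noteq> 0\<^sub>v n" for v
        using no that unfolding diff k by force
      fix i assume i: "i < n - m"
      \<comment> \<open>Here the dimension \<open>n - m\<close> may be 1, where the transference
        constant is exactly 4/3; the crude bound 4 on the root suffices for the factor 3/2.\<close>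
      have "root (Suc i) 4 \<le> root (Suc i) (4 ^ Suc i)"
        by (intro real_root_le_mono) simp_all
      also have "\<dots> = 4" by (intro real_root_power_cancel) simp_all
      finally have "root (Suc i) 4 \<le> 4" .
      then have "real (Suc i) / 3 * root (Suc i) 4 \<le> real (Suc i) / 3 * 4"
        by (intro mult_left_mono) auto
      also have "\<dots> < 3 / 2 * real (n - m)" using i by simp
      finally show "real (Suc i) / 3 * root (Suc i) 4 < 3 / 2 * real (n - m)" .
    qed (use l w x0 in auto)
    then show False using ns A by (simp add: nullspace_polyhedron_def)
  qed
  then obtain z where z: "z \<in> mat_kernel A" "real_vec z \<noteq> 0\<^sub>v n" "vec_norm (real_vec z) < k" by auto
  have zc: "z \<in> carrier_vec n" and Az: "A *\<^sub>v z = 0\<^sub>v m"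
    using z(1) mat_kernelD[OF A] by auto
  have "z \<noteq> 0\<^sub>v n"
    using z(2) by (auto simp: map_vec_def zero_vec_def)
  then show ?thesis
    using zc Az z(3) by (intro bexI[of _ z] conjI int_box_vec_norm) auto
qed

section \<open>The union bounds for the two reformulations\<close>

theorem rangespace_almost_all:
  assumes m: "0 < m" and n: "5 \<le> n"
    and l: "l1 \<in> carrier_vec m" "l2 \<in> carrier_vec n" and w: "w1 \<in> carrier_vec m" "w2 \<in> carrier_vec n"
    and lw: "\<And>i. i < n \<Longrightarrow> l2 $ i < w2 $ i"
    and M: "(2 * real n * vec_norm (real_vec ((w1 @\<^sub>v w2) - (l1 @\<^sub>v l2)))) powr (real n / real m + 1) < real M"
  shows "for_almost_all n (G_mats m n M) (\<lambda>A. rangespace_solved_at_rootnode A l1 w1 l2 w2)"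
proof -
  define \<Delta> where "\<Delta> = vec_norm (real_vec ((w1 @\<^sub>v w2) - (l1 @\<^sub>v l2)))"
  define k where "k = 44 / 100 * real n * \<Delta>"
  define D where "D = real n * \<Delta>"
  let ?S = "{A \<in> G_mats m n M. \<not> rangespace_solved_at_rootnode A l1 w1 l2 w2}"
  have "(w1 @\<^sub>v w2) - (l1 @\<^sub>v l2) = (w1 - l1) @\<^sub>v (w2 - l2)"
    using l w by (intro eq_vecI) auto
  then have "\<Delta>\<^sup>2 = (vec_norm (real_vec (w1 - l1)))\<^sup>2 + (vec_norm (real_vec (w2 - l2)))\<^sup>2"
    using l w vec_norm_append[of "w1 - l1" m "w2 - l2" n] by (simp add: \<Delta>_def)
  moreover have "real n \<le> (vec_norm (real_vec (w2 - l2)))\<^sup>2"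
    by (rule nonempty_box_norm[OF w(2) l(2) lw])
  \<comment> \<open>From \<open>n \<ge> 5\<close> the squared norm is at least 4, which gives
    \<open>D \<ge> 10\<close> below.\<close>
  ultimately have "2\<^sup>2 \<le> \<Delta>\<^sup>2" using n by (simp add: add_increasing order_trans[of 4 "real n"])
  then have \<Delta>: "2 \<le> \<Delta>"
    by (rule power2_le_imp_le) (simp add: \<Delta>_def)
  have "5 * 2 \<le> D" unfolding D_def using n \<Delta> by (intro mult_mono) auto
  then have D: "10 \<le> D" by simp
  have kD: "k = 44 / 100 * D" by (simp add: k_def D_def)
  have k0: "0 \<le> k" using D by (simp add: kD)
  have "card ?S * M ^ m \<le> card (int_box m k) * card (int_box n k) * M ^ (m * n)"
  proof (rule card_bad_mats)
    fix A assume A: "A \<in> ?S"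
    then have "A \<in> carrier_mat m n" by (simp add: G_mats_def)
    from rangespace_bad_vector[OF this n l w _ k_def[unfolded \<Delta>_def]] A
    show "A \<in> G_mats m n M \<and> (\<exists>z\<in>int_box n k. z \<noteq> 0\<^sub>v n \<and> A *\<^sub>v z \<in> int_box m k)"
      by simp
  qed (use card_int_box[OF k0] in \<open>auto simp: int_box_def\<close>)
  then have "real (card ?S) * real M ^ m \<le> real (card (int_box m k)) * real (card (int_box n k)) * real M ^ (m * n)"
    by (simp only: of_nat_mult[symmetric] of_nat_power[symmetric] of_nat_le_iff)
  also have "\<dots> \<le> (D ^ m * D ^ n) * real M ^ (m * n)"
  proof (intro mult_right_mono mult_mono)
    \<comment> \<open>As \<open>2 * k + 1 = 0.88 * D + 1\<close>, the rounding term fits below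
      \<open>D\<close> once \<open>D \<ge> 10\<close>.\<close>
    have le: "(2 * k + 1) ^ j \<le> D ^ j" for j
      using D by (intro power_mono) (auto simp: kD)
    show "real (card (int_box m k)) \<le> D ^ m" "real (card (int_box n k)) \<le> D ^ n"
      using card_int_box(2)[OF k0] le order_trans by blast+
  qed (use D in auto)
  finally have upper: "real (card ?S) * real M ^ m \<le> D ^ (n + m) * real M ^ (m * n)"
    by (simp add: power_add mult.commute)
  have "real n / real m + 1 = real (n + m) / real m"
    using m by (simp add: field_simps)
  \<comment> \<open>The hypothesis on \<open>M\<close> beats the number of pairs, at most
    \<open>D ^ (n + m)\<close>, by the factor \<open>2 ^ (n + m)\<close>, which is at least the
    required \<open>2 ^ n\<close>.\<close>
  then have "(2 * D) ^ (n + m) < real M ^ m"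
    using M m D unfolding D_def \<Delta>_def[symmetric] mult.assoc by (intro power_less_of_powr) auto
  then have "real (card ?S) * (2 * D) ^ (n + m) \<le> real (card ?S) * real M ^ m"
    by (intro mult_left_mono) auto
  then have "D ^ (n + m) * (real (card ?S) * 2 ^ (n + m)) \<le> D ^ (n + m) * real M ^ (m * n)"
    using upper by (simp add: power_mult_distrib mult.commute mult.left_commute)
  then have main: "real (card ?S) * 2 ^ (n + m) \<le> real M ^ (m * n)"
    using D by (simp only: mult_le_cancel_left_pos zero_less_power)
  have "real (card ?S) * 2 ^ n \<le> real (card ?S) * 2 ^ (n + m)"
    by (intro mult_left_mono power_increasing) auto
  then have "real (card ?S) * 2 ^ n \<le> real M ^ (m * n)"
    using main by linarith
  then show ?thesis
    by (simp add: for_almost_all_def card_G_mats field_simps)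
qed

theorem nullspace_almost_all:
  assumes m: "0 < m" and n: "2 \<le> n"
    and l: "l2 \<in> carrier_vec n" and w: "w2 \<in> carrier_vec n"
    and lw: "\<And>i. i < n \<Longrightarrow> l2 $ i < w2 $ i"
    and chi: "1 / 2 \<le> chi m n M" and M0: "0 < M"
    and M: "(12 * real (n - m) * vec_norm (real_vec (w2 - l2))) powr (real n / real m) < real M"
  shows "for_almost_all n (G'_mats m n M) (\<lambda>A. nullspace_solved_at_rootnode A l1 l2 w2)"
proof (cases "m < n")
  case False
  \<comment> \<open>Here \<open>n - m = 0\<close>: there are no variables, so the condition on the
    levels is vacuous.\<close>
  have "nullspace_solved_at_rootnode A l1 l2 w2" if "A \<in> G'_mats m n M" for A
    using that False
    by (auto simp: nullspace_solved_at_rootnode_def solves_at_rootnode_def G'_mats_def G_mats_def)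
  then have none: "{A \<in> G'_mats m n M. \<not> nullspace_solved_at_rootnode A l1 l2 w2} = {}" by auto
  show ?thesis unfolding for_almost_all_def none by simp
next
  case True
  define \<Delta> where "\<Delta> = vec_norm (real_vec (w2 - l2))"
  define k where "k = 3 / 2 * real (n - m) * \<Delta>"
  define D where "D = real (n - m) * \<Delta>"
  let ?S = "{A \<in> G'_mats m n M. \<not> nullspace_solved_at_rootnode A l1 l2 w2}"
  have "1\<^sup>2 \<le> \<Delta>\<^sup>2"
    using nonempty_box_norm[OF w l lw] n by (simp add: \<Delta>_def)
  then have \<Delta>: "1 \<le> \<Delta>"
    by (rule power2_le_imp_le) (simp add: \<Delta>_def)
  have "1 * 1 \<le> D" unfolding D_def using True \<Delta> by (intro mult_mono) auto
  then have D: "1 \<le> D" by simp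
  have kD: "k = 3 / 2 * D" by (simp add: k_def D_def)
  have k0: "0 \<le> k" using D by (simp add: kD)
  have "card ?S * M ^ m \<le> card {0\<^sub>v m :: int vec} * card (int_box n k) * M ^ (m * n)"
  proof (rule card_bad_mats)
    fix A assume A: "A \<in> ?S"
    then have "A \<in> carrier_mat m n" by (simp add: G'_mats_def G_mats_def)
    from nullspace_bad_vector[OF this l w _ k_def[unfolded \<Delta>_def]] A
    show "A \<in> G_mats m n M \<and> (\<exists>z\<in>int_box n k. z \<noteq> 0\<^sub>v n \<and> A *\<^sub>v z \<in> {0\<^sub>v m})"
      by (auto simp: G'_mats_def)
  qed (use card_int_box[OF k0] in \<open>auto simp: int_box_def\<close>)
  then have "real (card ?S) * real M ^ m \<le> real (card (int_box n k)) * real M ^ (m * n)"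
    by (simp only: of_nat_mult[symmetric] of_nat_power[symmetric] of_nat_le_iff) simp
  also have "\<dots> \<le> (4 * D) ^ n * real M ^ (m * n)"
  proof (intro mult_right_mono)
    \<comment> \<open>As \<open>2 * k + 1 = 3 * D + 1\<close> and \<open>D \<ge> 1\<close>, the
      rounding term is absorbed in the factor 4.\<close>
    have "(2 * k + 1) ^ n \<le> (4 * D) ^ n"
      using D by (intro power_mono) (auto simp: kD)
    then show "real (card (int_box n k)) \<le> (4 * D) ^ n"
      using card_int_box(2)[OF k0, of n] by linarith
  qed auto
  finally have upper: "real (card ?S) * real M ^ m \<le> (4 * D) ^ n * real M ^ (m * n)" .
  have "(12 * D) powr (real n / real m) < real M"
    using M unfolding D_def \<Delta>_def by (simp only: mult.assoc)
  then have less: "(12 * D) ^ n < real M ^ m"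
    using m D by (intro power_less_of_powr) auto
  \<comment> \<open>Of the factor 12, the cube uses 4 and the remaining 3 makes the bad matrices a
    fraction of at most \<open>1 / 3 ^ n\<close> of all matrices in \<open>G_mats\<close>.\<close>
  have "(4 * D) ^ n * (real (card ?S) * 3 ^ n) = real (card ?S) * (4 * D * 3) ^ n"
    by (simp only: power_mult_distrib ac_simps)
  also have "\<dots> \<le> real (card ?S) * real M ^ m"
    using less by (intro mult_left_mono) (simp_all add: less_imp_le)
  also note upper
  finally have main: "real (card ?S) * 3 ^ n \<le> real M ^ (m * n)"
    by (rule mult_left_le_imp_le) (use D in simp)
  \<comment> \<open>The spare power of 3/2 pays for passing from \<open>G_mats\<close> to
    \<open>G'_mats\<close>, which by \<open>chi\<close> has at least half as many elements.\<close>
  have "(2::real) * 2 ^ n \<le> 3 ^ n"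
    using n
  proof (induction n rule: dec_induct)
    case (step k)
    have "(0::real) \<le> 3 ^ k" by simp
    then show ?case using step.IH unfolding power_Suc by linarith
  qed simp
  then have "real (card ?S) * (2 * 2 ^ n) \<le> real (card ?S) * 3 ^ n"
    by (intro mult_left_mono) auto
  then have "real (card ?S) * (2 * 2 ^ n) \<le> real M ^ (m * n)"
    using main by linarith
  moreover have "real M ^ (m * n) \<le> 2 * real (card (G'_mats m n M))"
    using chi M0 by (simp add: chi_def card_G_mats field_simps)
  ultimately show ?thesis
    by (simp add: for_almost_all_def field_simps)
qed

theorem theorem1:
  shows "\<exists>d1 d2 :: real. 0 < d1 \<and> d1 \<le> 2 \<and> 0 < d2 \<and> d2 \<le> 12 \<and>
    (\<forall>(m :: nat) (n :: nat) (M :: nat) (l1 :: int vec) (w1 :: int vec) (l2 :: int vec) (w2 :: int vec).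
       0 < m \<and> 5 \<le> n \<and> 0 < M \<and>
       l1 \<in> carrier_vec m \<and> w1 \<in> carrier_vec m \<and>
       l2 \<in> carrier_vec n \<and> w2 \<in> carrier_vec n \<and>
       (\<forall>i<n. l2 $ i < w2 $ i) \<longrightarrow>
       (real M > (d1 * real n * vec_norm (real_vec ((w1 @\<^sub>v w2) - (l1 @\<^sub>v l2))))
                   powr (real n / real m + 1) \<longrightarrow>
          for_almost_all n (G_mats m n M) (\<lambda>A. rangespace_solved_at_rootnode A l1 w1 l2 w2)) \<and>
       (m \<le> n \<and> w1 = l1 \<and> chi m n M \<ge> 1 / 2 \<longrightarrow>
        real M > (d2 * real (n - m) * vec_norm (real_vec (w2 - l2))) powr (real n / real m) \<longrightarrow>
          for_almost_all n (G'_mats m n M) (\<lambda>A. nullspace_solved_at_rootnode A l1 l2 w2)))"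
proof -
  have "for_almost_all n (G_mats m n M) (\<lambda>A. rangespace_solved_at_rootnode A l1 w1 l2 w2)"
    if "0 < m" "5 \<le> n" "l1 \<in> carrier_vec m" "w1 \<in> carrier_vec m"
      "l2 \<in> carrier_vec n" "w2 \<in> carrier_vec n" "\<forall>i<n. l2 $ i < w2 $ i"
      "(2 * real n * vec_norm (real_vec ((w1 @\<^sub>v w2) - (l1 @\<^sub>v l2)))) powr (real n / real m + 1) < real M"
    for m n M :: nat and l1 w1 l2 w2 :: "int vec"
    by (rule rangespace_almost_all[OF that(1-3,5,4,6) _ that(8)]) (simp add: that(7))
  moreover have "for_almost_all n (G'_mats m n M) (\<lambda>A. nullspace_solved_at_rootnode A l1 l2 w2)"
    if "0 < m" "5 \<le> n" "0 < M" "l2 \<in> carrier_vec n" "w2 \<in> carrier_vec n"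
      "\<forall>i<n. l2 $ i < w2 $ i" "1 / 2 \<le> chi m n M"
      "(12 * real (n - m) * vec_norm (real_vec (w2 - l2))) powr (real n / real m) < real M"
    for m n M :: nat and l1 l2 w2 :: "int vec"
    by (rule nullspace_almost_all[OF that(1) _ that(4,5) _ that(7,3,8)]) (use that(2,6) in simp_all)
  \<comment> \<open>Both constants are taken at their upper limits.\<close>
  ultimately show ?thesis
    by (intro exI[of _ "2::real"] exI[of _ "12::real"]) simp
qed

end
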